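(* Let $G$ be a finite connected graph, $r\ge 1$, $v \in V(G)$, and $\mathrm{Supp}_r(v,G)=\{S_1,\dots,S_n\}$. If $\mathrm{Supp}_r(v,G)$ is connected and $N(v) \subseteq N[S_i]$ for each $i \in \{1,\dots,n\}$, then $$\mathrm{Ind}_r(G) \simeq \bigvee_{i=1}^n \Sigma^r (\mathrm{Ind}_r(G-N[S_i])).$$
   Context: For $r\ge 1$, $\mathrm{Ind}_r(G)$ is the simplicial complex on $V(G)$ whose simplices are the sets $A\subseteq V(G)$ such that every connected component of the induced subgraph $G[A]$ has at most $r$ vertices. For $S\subseteq V(G)$, $N(S)$ is the set of vertices adjacent to some vertex of $S$, $N[S]=N(S)\cup S$, $N(v)=N(\{v\})$, and $G-U$ denotes the induced subgraph $G[V(G)\setminus U]$. For $r\ge 0$, an $r$-support of $v$ in $G$ is a set $S\subseteq V(G)$ with $v\notin S$, $|S|=r$ and $G[S\cup\{v\}]$ connected; $\mathrm{Supp}_r(v,G)$ is the set of all $r$-supports of $v$. $\mathrm{Supp}_r(v,G)$ is called connected if $G[S]$ is connected for every $S\in\mathrm{Supp}_r(v,G)$. $\Sigma^r$ denotes the $r$-fold suspension, with the convention that the suspension of the empty space is $\mathbb{S}^0$ (so $\Sigma^r(\emptyset)\simeq \mathbb{S}^{r-1}$), and $\mathrm{Ind}_r$ of the graph with no vertices is the empty complex. *)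

theory Defs
  imports "HOL-Analysis.Analysis" "Graph_Theory.Digraph_Component"
begin

section \<open>Graphs\<close>

text \<open>
  Finite simple graphs are the digraphs satisfying the locale predicate \<^const>\<open>graph\<close>: finite,
  loop-free, without parallel arcs, and symmetric.  The induced subgraph $G[A]$ is
  \<^term>\<open>induce_subgraph G A\<close>; the library notion of a connected graph excludes the graph without
  vertices.
\<close>

abbreviation connected_graph :: "('a, 'b) pre_digraph \<Rightarrow> bool"
  where "connected_graph \<equiv> Digraph_Component.connected"

definition component_of_graph :: "('a, 'b) pre_digraph \<Rightarrow> ('a, 'b) pre_digraph \<Rightarrow> bool"
  where "component_of_graph G C \<longleftrightarrow> pre_digraph.max_subgraph G connected_graph C"

definition nbhd :: "('a, 'b) pre_digraph \<Rightarrow> 'a set \<Rightarrow> 'a set"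
  where "nbhd G S = {u \<in> verts G. \<exists>s\<in>S. s \<rightarrow>\<^bsub>G\<^esub> u}"

definition closed_nbhd :: "('a, 'b) pre_digraph \<Rightarrow> 'a set \<Rightarrow> 'a set"
  where "closed_nbhd G S = nbhd G S \<union> S"

definition delete_verts :: "('a, 'b) pre_digraph \<Rightarrow> 'a set \<Rightarrow> ('a, 'b) pre_digraph"
  where "delete_verts G U = induce_subgraph G (verts G - U)"

definition Supp :: "nat \<Rightarrow> 'a \<Rightarrow> ('a, 'b) pre_digraph \<Rightarrow> 'a set set"
  where "Supp r v G =
    {S. S \<subseteq> verts G \<and> v \<notin> S \<and> card S = r \<and> connected_graph (induce_subgraph G (insert v S))}"

definition Supp_connected :: "nat \<Rightarrow> 'a \<Rightarrow> ('a, 'b) pre_digraph \<Rightarrow> bool"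
  where "Supp_connected r v G \<longleftrightarrow> (\<forall>S\<in>Supp r v G. connected_graph (induce_subgraph G S))"


section \<open>Higher independence complexes and geometric realization\<close>

text \<open>
  Abstract simplicial complexes are families of finite sets; the empty set always belongs to
  \<open>Ind r G\<close>, and the realization of the complex with no other simplex is the empty space.
\<close>

definition Ind :: "nat \<Rightarrow> ('a, 'b) pre_digraph \<Rightarrow> 'a set set"
  where "Ind r G =
    {A. A \<subseteq> verts G \<and>
        (\<forall>C. component_of_graph (induce_subgraph G A) C \<longrightarrow> card (verts C) \<le> r)}"

text \<open>
  Points of the realization are given by their barycentric coordinates.  For a complex with finitely
  many vertices the subspace topology used here is the usual topology of the realization.
\<close>

definition realization :: "'a set set \<Rightarrow> ('a \<Rightarrow> real) topology"
  where "realization K =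
    subtopology (powertop_real UNIV)
      {x. (\<forall>a. 0 \<le> x a) \<and> {a. x a \<noteq> 0} \<in> K \<and> (\<Sum>a | x a \<noteq> 0. x a) = 1}"


section \<open>Quotients, suspensions and wedges\<close>

text \<open>
  The finest topology on \<open>Y\<close> making \<open>q\<close> continuous: the quotient topology on \<open>q ` topspace X\<close>,
  together with the points of \<open>Y\<close> outside this image as isolated points.
\<close>

definition final_topology :: "'a topology \<Rightarrow> ('a \<Rightarrow> 'b) \<Rightarrow> 'b set \<Rightarrow> 'b topology"
  where "final_topology X q Y =
    topology (\<lambda>U. U \<subseteq> Y \<and> openin X {x \<in> topspace X. q x \<in> U})"

lemma istopology_final_topology:
  "istopology (\<lambda>U. U \<subseteq> Y \<and> openin X {x \<in> topspace X. q x \<in> U})"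
proof -
  have "openin X {x \<in> topspace X. q x \<in> U \<inter> V}"
    if "openin X {x \<in> topspace X. q x \<in> U}" "openin X {x \<in> topspace X. q x \<in> V}" for U V
  proof -
    have "{x \<in> topspace X. q x \<in> U \<inter> V} = {x \<in> topspace X. q x \<in> U} \<inter> {x \<in> topspace X. q x \<in> V}"
      by blast
    with that show ?thesis by auto
  qed
  moreover have "openin X {x \<in> topspace X. q x \<in> \<Union>\<U>}"
    if "\<And>U. U \<in> \<U> \<Longrightarrow> openin X {x \<in> topspace X. q x \<in> U}" for \<U>
  proof -
    have "{x \<in> topspace X. q x \<in> \<Union>\<U>} = (\<Union>U\<in>\<U>. {x \<in> topspace X. q x \<in> U})"
      by blast
    with that show ?thesis by auto
  qed
  ultimately show ?thesis
    unfolding istopology_def by blast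
qed

lemma openin_final_topology:
  "openin (final_topology X q Y) U \<longleftrightarrow> U \<subseteq> Y \<and> openin X {x \<in> topspace X. q x \<in> U}"
  by (simp add: final_topology_def istopology_final_topology)

lemma topspace_final_topology:
  assumes "q ` topspace X \<subseteq> Y"
  shows "topspace (final_topology X q Y) = Y"
proof -
  have "{x \<in> topspace X. q x \<in> Y} = topspace X"
    using assms by blast
  then have "openin (final_topology X q Y) Y"
    by (simp add: openin_final_topology)
  then show ?thesis
    by (metis openin_final_topology openin_subset openin_topspace subset_antisym)
qed

lemma quotient_map_final_topology:
  "quotient_map X (final_topology X q (q ` topspace X)) q"
  by (auto simp: quotient_map_def topspace_final_topology openin_final_topology)

text \<open>
  The suspension of a space with points in some type has points in the same type, so that it can be
  iterated a variable number of times.  \<open>Base x\<close> is a point of the space one starts with, and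
  \<open>Meridian x t\<close> is the class of \<open>(x, t)\<close> with \<open>0 < t < 1\<close>.
\<close>

datatype 'a susp_point = Base 'a | North | South | Meridian "'a susp_point" real

definition susp_proj :: "'a susp_point \<times> real \<Rightarrow> 'a susp_point"
  where "susp_proj = (\<lambda>(x, t). if t = 0 then South else if t = 1 then North else Meridian x t)"

text \<open>
  The unreduced suspension: the quotient of $X \times [0,1]$ collapsing $X \times \{0\}$ and
  $X \times \{1\}$ to one pole each.  The poles are present also when $X$ is empty, so that the
  suspension of the empty space is the two-point discrete space.
\<close>

definition suspension :: "'a susp_point topology \<Rightarrow> 'a susp_point topology"
  where "suspension X =
    final_topology (prod_topology X (top_of_set {0..1})) susp_proj
      ({North, South} \<union> susp_proj ` (topspace X \<times> {0..1}))"

definition base_copy :: "'a topology \<Rightarrow> 'a susp_point topology"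
  where "base_copy X = final_topology X Base (Base ` topspace X)"

definition iterated_suspension :: "nat \<Rightarrow> 'a topology \<Rightarrow> 'a susp_point topology"
  where "iterated_suspension r X = (suspension ^^ r) (base_copy X)"

lemma homeomorphic_map_base_copy: "homeomorphic_map X (base_copy X) Base"
  unfolding base_copy_def
  by (rule bijective_open_imp_homeomorphic_map)
    (auto simp: quotient_imp_continuous_map quotient_map_final_topology topspace_final_topology
      open_map_def openin_final_topology inj_on_def image_iff conj_commute
      dest: openin_subset intro: back_subst[of "openin X"])

lemma topspace_suspension:
  "topspace (suspension X) = {North, South} \<union> susp_proj ` (topspace X \<times> {0..1})"
  unfolding suspension_def by (rule topspace_final_topology) auto

lemma quotient_map_suspension:
  assumes "topspace X \<noteq> {}"
  shows "quotient_map (prod_topology X (top_of_set {0..1})) (suspension X) susp_proj"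
proof -
  obtain x where x: "x \<in> topspace X" using assms by blast
  have "North = susp_proj (x, 1)" "South = susp_proj (x, 0)"
    by (auto simp: susp_proj_def)
  then have "{North, South} \<union> susp_proj ` (topspace X \<times> {0..1}) = susp_proj ` (topspace X \<times> {0..1})"
    using x by force
  then show ?thesis
    using quotient_map_final_topology[of "prod_topology X (top_of_set {0..1})" susp_proj]
    by (simp add: suspension_def)
qed

lemma suspension_empty:
  assumes "topspace X = {}"
  shows "suspension X = discrete_topology {North, South}"
  unfolding topology_eq suspension_def openin_final_topology openin_discrete_topology
    topspace_prod_topology assms by simp

text \<open>
  The wedge of a family of pointed spaces: the quotient of the disjoint union in which all the base
  points \<open>p i\<close> are identified to the single point \<open>None\<close>.  The empty wedge is a point.
\<close>

definition wedge_proj :: "('i \<Rightarrow> 'a) \<Rightarrow> 'i \<times> 'a \<Rightarrow> ('i \<times> 'a) option"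
  where "wedge_proj p = (\<lambda>(i, x). if x = p i then None else Some (i, x))"

definition wedge :: "'i set \<Rightarrow> ('i \<Rightarrow> 'a topology) \<Rightarrow> ('i \<Rightarrow> 'a) \<Rightarrow> ('i \<times> 'a) option topology"
  where "wedge I X p =
    final_topology (sum_topology X I) (wedge_proj p)
      (insert None (wedge_proj p ` topspace (sum_topology X I)))"

lemma wedge_empty: "wedge {} X p = discrete_topology {None}"
  by (auto simp: topology_eq wedge_def openin_final_topology)

lemma quotient_map_wedge:
  assumes "I \<noteq> {}" and "\<And>i. i \<in> I \<Longrightarrow> p i \<in> topspace (X i)"
  shows "quotient_map (sum_topology X I) (wedge I X p) (wedge_proj p)"
proof -
  obtain i where i: "i \<in> I" using assms by blast
  have "None = wedge_proj p (i, p i)"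
    by (auto simp: wedge_proj_def)
  then have "None \<in> wedge_proj p ` topspace (sum_topology X I)"
    using i assms(2) by (force simp: topspace_sum_topology)
  then show ?thesis
    using quotient_map_final_topology[of "sum_topology X I" "wedge_proj p"]
    by (simp add: wedge_def insert_absorb)
qed

text \<open>
  A pole serves as base point of an iterated suspension.
\<close>

lemma North_in_iterated_suspension:
  "r \<ge> 1 \<Longrightarrow> North \<in> topspace (iterated_suspension r X)"
  by (cases r) (auto simp: iterated_suspension_def topspace_suspension)

end

theory Submission
  imports Defs
begin

text \<open>
  A face of \<open>Ind r G\<close> outside the star of \<open>v\<close> contains an \<open>r\<close>-support \<open>S\<close> of \<open>v\<close>. Since \<open>S\<close> is
  connected with \<open>r\<close> vertices it is a component of the face, and since \<open>N(v) \<subseteq> N[S]\<close> it is the only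
  support in the face. So \<open>Ind r G\<close> is the star of \<open>v\<close> with the joins \<open>S * L\<^sub>S\<close> attached along
  \<open>\<partial>S * L\<^sub>S\<close>, where \<open>L\<^sub>S = Ind r (G - N[S])\<close>, and collapsing the contractible star leaves the wedge
  of the quotients \<open>(S * L\<^sub>S) / (\<partial>S * L\<^sub>S)\<close>.

  The \<open>r\<close>-fold suspension of \<open>L\<^sub>S\<close> is the join of \<open>L\<^sub>S\<close> with an octahedral \<open>(r - 1)\<close>-sphere, one
  of whose facets is identified with \<open>S\<close>. The part of this join not containing that facet
  contracts to a vertex, and collapsing it leaves the same quotient. Both collapses are made explicit by
  multiplying a point with the minimum of its coordinates over \<open>S\<close>, and both contractions are
  restrictions of explicit homotopies of the whole space, so that the collapses are homotopy
  equivalences.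
\<close>

section \<open>Supports and higher independence complexes\<close>

text \<open>Connectedness of the subgraph spanned by \<open>C\<close>, phrased by cuts instead of
  walks. Only pairs inside \<open>C\<close> matter, so no induced subgraph has to be formed, and as
  for \<open>connected_graph\<close> the empty set is excluded.\<close>

definition cut_connected :: "('a \<times> 'a) set \<Rightarrow> 'a set \<Rightarrow> bool" where
  "cut_connected E C \<longleftrightarrow>
    C \<noteq> {} \<and> (\<forall>D\<subseteq>C. D \<noteq> {} \<and> D \<noteq> C \<longrightarrow> (\<exists>x\<in>D. \<exists>y\<in>C - D. (x, y) \<in> E))"

lemma cut_connected_singleton: "cut_connected E {x}"
  unfolding cut_connected_def by auto

lemma cut_connected_mono: "cut_connected E C \<Longrightarrow> E \<subseteq> E' \<Longrightarrow> cut_connected E' C"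
  unfolding cut_connected_def by blast

lemma cut_connected_restrict: "cut_connected (Restr E C) C \<longleftrightarrow> cut_connected E C"
  unfolding cut_connected_def by blast

text \<open>A cut of the union either cuts \<open>C\<close> or \<open>D\<close> properly, and then
  has a crossing edge there, or it separates \<open>C\<close> from \<open>D\<close>, and then the
  common vertex or the joining edge decides.\<close>

lemma cut_connected_Un:
  assumes "sym E" "cut_connected E C" "cut_connected E D"
    and "C \<inter> D \<noteq> {} \<or> (\<exists>x\<in>C. \<exists>y\<in>D. (x, y) \<in> E)"
  shows "cut_connected E (C \<union> D)"
  unfolding cut_connected_def
proof (intro conjI allI impI)
  show "C \<union> D \<noteq> {}"
    using assms(2) by (auto simp: cut_connected_def)
  fix X assume X: "X \<subseteq> C \<union> D" "X \<noteq> {} \<and> X \<noteq> C \<union> D"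
  have C: "\<exists>x\<in>X. \<exists>y\<in>C - X. (x, y) \<in> E" if "C \<inter> X \<noteq> {}" "\<not> C \<subseteq> X"
    using assms(2)[unfolded cut_connected_def, THEN conjunct2, rule_format, of "C \<inter> X"] that by blast
  have D: "\<exists>x\<in>X. \<exists>y\<in>D - X. (x, y) \<in> E" if "D \<inter> X \<noteq> {}" "\<not> D \<subseteq> X"
    using assms(3)[unfolded cut_connected_def, THEN conjunct2, rule_format, of "D \<inter> X"] that by blast
  show "\<exists>x\<in>X. \<exists>y\<in>C \<union> D - X. (x, y) \<in> E"
  proof (cases "(C \<inter> X \<noteq> {} \<and> \<not> C \<subseteq> X) \<or> (D \<inter> X \<noteq> {} \<and> \<not> D \<subseteq> X)")
    case True
    then show ?thesis using C D by blast
  next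
    case False
    then have "(C \<subseteq> X \<and> D \<inter> X = {}) \<or> (D \<subseteq> X \<and> C \<inter> X = {})"
      using X by blast
    moreover have "C \<noteq> {}" "D \<noteq> {}" using assms(2,3) by (auto simp: cut_connected_def)
    ultimately show ?thesis using assms(4) symD[OF assms(1)] by blast
  qed
qed

lemma cut_connected_insert:
  assumes "sym E" "cut_connected E C" "x \<in> C" "(x, y) \<in> E"
  shows "cut_connected E (insert y C)"
  using cut_connected_Un[OF assms(1,2) cut_connected_singleton, of y] assms(3,4) by auto

text \<open>Start at \<open>v\<close> and add one vertex at a time across the cut around the part
  already built. This is how an \<open>r\<close>-support is extracted from a connected set that is
  too large.\<close>

lemma cut_connected_grow:
  assumes "sym E" "cut_connected E C" "v \<in> C" "finite C" "n < card C"
  shows "\<exists>S\<subseteq>C. v \<notin> S \<and> card S = n \<and> cut_connected E (insert v S)"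
  using assms(5)
proof (induction n)
  case 0
  then show ?case by (intro exI[of _ "{}"]) (auto simp: cut_connected_singleton)
next
  case (Suc n)
  then obtain S where S: "S \<subseteq> C" "v \<notin> S" "card S = n" "cut_connected E (insert v S)"
    by auto
  have fin: "finite S" using S assms finite_subset by blast
  have "insert v S \<noteq> C"
    using S fin Suc.prems by auto
  then obtain x y where "x \<in> insert v S" "y \<in> C - insert v S" "(x, y) \<in> E"
    using assms(2)[unfolded cut_connected_def, THEN conjunct2, rule_format, of "insert v S"] S assms(3)
    by blast
  then have "cut_connected E (insert v (insert y S))"
    using cut_connected_insert[OF assms(1) S(4), of x y] by (simp add: insert_commute)
  then show ?case
    using S fin \<open>y \<in> C - insert v S\<close> by (intro exI[of _ "insert y S"]) auto
qed

text \<open>Reachability cannot leave a set without crossing edges; conversely the set of vertices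
  reachable from \<open>u\<close> is such a set. The relation is symmetrised because
  \<open>H\<close> may be any digraph, in particular an arbitrary subgraph competing for
  maximality.\<close>

lemma connected_graph_iff_cut_connected:
  assumes "wf_digraph H"
  shows "connected_graph H \<longleftrightarrow> cut_connected (arcs_ends H \<union> (arcs_ends H)\<inverse>) (verts H)"
    (is "_ = cut_connected ?E _")
proof -
  interpret H: wf_digraph H by (rule assms)
  interpret M: pair_wf_digraph "mk_symmetric H" by (rule H.wellformed_mk_symmetric)
  have adj: "(u, w) \<in> parcs (mk_symmetric H) \<longleftrightarrow> (u, w) \<in> ?E" for u w
    by (force simp: mk_symmetric_def arcs_ends_conv)
  show ?thesis
  proof
    assume conn: "connected_graph H"
    show "cut_connected ?E (verts H)"
      unfolding cut_connected_def
    proof (intro conjI allI impI)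
      show "verts H \<noteq> {}"
        using conn by (auto simp: connected_def strongly_connected_def)
      fix D assume D: "D \<subseteq> verts H" "D \<noteq> {} \<and> D \<noteq> verts H"
      then obtain u w where uw: "u \<in> D" "w \<in> verts H - D" by blast
      have "u \<rightarrow>\<^sup>*\<^bsub>with_proj (mk_symmetric H)\<^esub> w"
        using conn uw D by (auto simp: connected_def strongly_connected_def)
      then have "w \<notin> D \<Longrightarrow> \<exists>x\<in>D. \<exists>y\<in>verts H - D. (x, y) \<in> ?E"
      proof (induction rule: M.reachable_induct)
        case base
        then show ?case using uw by blast
      next
        case (step x y)
        have "(x, y) \<in> ?E" using step(2) by (simp add: adj)
        moreover from this have "y \<in> verts H" by (auto simp: arcs_ends_conv)
        ultimately show ?case using step by blast
      qed
      then show "\<exists>x\<in>D. \<exists>y\<in>verts H - D. (x, y) \<in> ?E" using uw by blast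
    qed
  next
    assume cut: "cut_connected ?E (verts H)"
    have "w \<in> {w. u \<rightarrow>\<^sup>*\<^bsub>with_proj (mk_symmetric H)\<^esub> w}" if "u \<in> verts H" "w \<in> verts H" for u w
    proof (rule ccontr)
      define D where "D = {w \<in> verts H. u \<rightarrow>\<^sup>*\<^bsub>with_proj (mk_symmetric H)\<^esub> w}"
      assume "w \<notin> {w. u \<rightarrow>\<^sup>*\<^bsub>with_proj (mk_symmetric H)\<^esub> w}"
      then have "D \<noteq> verts H" using that by (auto simp: D_def)
      moreover have "u \<in> D" "D \<subseteq> verts H" using that by (auto simp: D_def)
      ultimately obtain x y where xy: "x \<in> D" "y \<in> verts H - D" "(x, y) \<in> ?E"
        using cut[unfolded cut_connected_def, THEN conjunct2, rule_format, of D] by blast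
      then have "(x, y) \<in> parcs (mk_symmetric H)" by (simp add: adj)
      moreover have "u \<rightarrow>\<^sup>*\<^bsub>with_proj (mk_symmetric H)\<^esub> x" using xy(1) by (simp add: D_def)
      ultimately have "u \<rightarrow>\<^sup>*\<^bsub>with_proj (mk_symmetric H)\<^esub> y"
        by (rule M.reachable_adj_trans[rotated])
      with xy show False by (auto simp: D_def)
    qed
    then show "connected_graph H"
      using cut by (auto simp: connected_def strongly_connected_def cut_connected_def)
  qed
qed

lemma arcs_ends_induce_subgraph: "arcs_ends (induce_subgraph G C) = Restr (arcs_ends G) C"
  by (auto simp: arcs_ends_conv)

lemma connected_induce_subgraph_iff:
  assumes "graph G" "C \<subseteq> verts G"
  shows "connected_graph (induce_subgraph G C) \<longleftrightarrow> cut_connected (arcs_ends G) C"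
proof -
  interpret graph G by (rule assms)
  have "wf_digraph (induce_subgraph G C)"
    by (rule wellformed_induce_subgraph)
  moreover have "sym (arcs_ends G)" using sym_arcs by (simp add: symmetric_def)
  then have "Restr (arcs_ends G) C \<union> (Restr (arcs_ends G) C)\<inverse> = Restr (arcs_ends G) C"
    by (auto dest: symD)
  ultimately show ?thesis
    by (simp add: connected_graph_iff_cut_connected arcs_ends_induce_subgraph cut_connected_restrict)
qed

text \<open>Each connected subset lies in a maximal one, which spans a component, so bounding the
  components bounds all connected subsets. In this form components disappear and closure under
  subsets is immediate.\<close>

lemma in_Ind_iff:
  assumes "graph G"
  shows "A \<in> Ind r G \<longleftrightarrow>
    A \<subseteq> verts G \<and> (\<forall>C\<subseteq>A. cut_connected (arcs_ends G) C \<longrightarrow> card C \<le> r)"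
proof (cases "A \<subseteq> verts G")
  case False
  then show ?thesis by (simp add: Ind_def)
next
  case A: True
  interpret graph G by (rule assms)
  let ?E = "arcs_ends G" and ?GA = "induce_subgraph G A"
  have sE: "sym ?E" using sym_arcs by (simp add: symmetric_def)
  have finA: "finite A" using A finite_verts finite_subset by blast
  have "(\<forall>C. component_of_graph ?GA C \<longrightarrow> card (verts C) \<le> r) \<longleftrightarrow>
      (\<forall>C\<subseteq>A. cut_connected ?E C \<longrightarrow> card C \<le> r)"
  proof (intro iffI allI impI)
    fix C
    assume r: "\<forall>C\<subseteq>A. cut_connected ?E C \<longrightarrow> card C \<le> r" and "component_of_graph ?GA C"
    then have C: "subgraph C ?GA" "connected_graph C"
      by (auto simp: component_of_graph_def pre_digraph.max_subgraph_def)
    then have "cut_connected (arcs_ends C \<union> (arcs_ends C)\<inverse>) (verts C)"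
      using connected_graph_iff_cut_connected by (auto simp: subgraph_def)
    moreover have "arcs_ends C \<subseteq> ?E"
      using arcs_ends_mono[OF C(1)] by (auto simp: arcs_ends_induce_subgraph)
    ultimately have "cut_connected ?E (verts C)"
      by (elim cut_connected_mono) (use sE in \<open>auto dest: symD\<close>)
    moreover have "verts C \<subseteq> A" using C(1) by (auto simp: subgraph_def)
    ultimately show "card (verts C) \<le> r" using r by blast
  next
    fix C
    assume r: "\<forall>C. component_of_graph ?GA C \<longrightarrow> card (verts C) \<le> r"
      and C: "C \<subseteq> A" "cut_connected ?E C"
    \<comment> \<open>By finiteness \<open>C\<close> extends to an inclusion-maximal connected
      subset \<open>D\<close> of \<open>A\<close>.\<close>
    obtain D where D: "D \<subseteq> A" "cut_connected ?E D" "C \<subseteq> D"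
      and max: "\<And>D'. D' \<subseteq> A \<Longrightarrow> cut_connected ?E D' \<Longrightarrow> D \<subseteq> D' \<Longrightarrow> D' = D"
    proof -
      have "finite {D. D \<subseteq> A \<and> cut_connected ?E D \<and> C \<subseteq> D}" using finA by simp
      from finite_has_maximal2[OF this, of C] C obtain D where
        D: "D \<subseteq> A \<and> cut_connected ?E D \<and> C \<subseteq> D"
          "\<forall>D'\<in>{D. D \<subseteq> A \<and> cut_connected ?E D \<and> C \<subseteq> D}. D \<subseteq> D' \<longrightarrow> D = D'"
        by auto
      show ?thesis
        by (rule that[of D]) (use D in \<open>simp_all, metis order_trans\<close>)
    qed
    have DV: "D \<subseteq> verts G" using D A by blast
    have sub: "subgraph (induce_subgraph G D) ?GA"
      using D(1) DV A unfolding subgraph_def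
      by (auto simp: compatible_def intro!: wellformed_induce_subgraph)
    have "component_of_graph ?GA (induce_subgraph G D)"
      unfolding component_of_graph_def pre_digraph.max_subgraph_def
    proof (intro conjI allI impI sub notI)
      show "connected_graph (induce_subgraph G D)"
        using connected_induce_subgraph_iff[OF assms DV] D by simp
      fix H assume H: "H \<noteq> induce_subgraph G D \<and> subgraph (induce_subgraph G D) H"
        "subgraph H ?GA \<and> connected_graph H"
      have "cut_connected (arcs_ends H \<union> (arcs_ends H)\<inverse>) (verts H)"
        using H connected_graph_iff_cut_connected by (auto simp: subgraph_def)
      moreover have "arcs_ends H \<subseteq> ?E"
        using arcs_ends_mono[of H ?GA] H by (auto simp: arcs_ends_induce_subgraph)
      ultimately have "cut_connected ?E (verts H)"
        by (elim cut_connected_mono) (use sE in \<open>auto dest: symD\<close>)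
      moreover have "verts H \<subseteq> A" "D \<subseteq> verts H" using H by (auto simp: subgraph_def)
      ultimately have V: "verts H = D" using max by blast
      have wfH: "wf_digraph H" and comp: "tail H = tail G" "head H = head G"
        using H by (auto simp: subgraph_def compatible_def)
      \<comment> \<open>Maximality of a component concerns subgraphs, not vertex sets: once
        \<open>H\<close> has vertex set \<open>D\<close>, its arcs have to be compared as
        well.\<close>
      have "arcs H = arcs (induce_subgraph G D)"
      proof
        show "arcs (induce_subgraph G D) \<subseteq> arcs H" using H by (auto simp: subgraph_def)
        show "arcs H \<subseteq> arcs (induce_subgraph G D)"
          using H V comp wf_digraph.tail_in_verts[OF wfH] wf_digraph.head_in_verts[OF wfH]
          by (auto simp: subgraph_def)
      qed
      with V comp have "H = induce_subgraph G D"
        by (simp add: pre_digraph.equality)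
      with H show False by blast
    qed
    with r have "card D \<le> r" by force
    moreover have "card C \<le> card D" using D finA by (meson card_mono finite_subset)
    ultimately show "card C \<le> r" by linarith
  qed
  with A show ?thesis by (simp add: Ind_def)
qed

lemma Ind_empty: "graph G \<Longrightarrow> {} \<in> Ind r G"
  by (auto simp: in_Ind_iff cut_connected_def)

lemma Ind_subset: "graph G \<Longrightarrow> A \<in> Ind r G \<Longrightarrow> B \<subseteq> A \<Longrightarrow> B \<in> Ind r G"
  by (auto simp: in_Ind_iff)

lemma graph_delete_verts:
  assumes "graph G" shows "graph (delete_verts G U)"
proof -
  interpret graph G by (rule assms)
  have "induced_subgraph (delete_verts G U) G"
    unfolding delete_verts_def by (rule induced_induce) auto
  then show ?thesis
    using induced_graph_imp_symmetric[OF sym_arcs] digraphI_induced digraph.graphI by blast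
qed

lemma Supp_iff:
  assumes "graph G" "v \<in> verts G"
  shows "S \<in> Supp r v G \<longleftrightarrow>
    S \<subseteq> verts G \<and> v \<notin> S \<and> card S = r \<and> cut_connected (arcs_ends G) (insert v S)"
  using connected_induce_subgraph_iff[OF assms(1), of "insert v S"] assms(2)
  by (auto simp: Supp_def)

section \<open>Combinatorics of the supports of \<open>v\<close>\<close>

locale good_supports =
  fixes G :: "('a, 'b) pre_digraph" and r :: nat and v :: 'a
  assumes graph: "graph G"
    and r_pos: "r \<ge> 1" and v_in: "v \<in> verts G"
    and Supp_conn: "Supp_connected r v G"
    and nbhd_sub: "\<forall>S\<in>Supp r v G. nbhd G {v} \<subseteq> closed_nbhd G S"
begin

sublocale graph G by (rule graph)

abbreviation "E \<equiv> arcs_ends G"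
abbreviation "K \<equiv> Ind r G"
abbreviation "supports \<equiv> Supp r v G"
abbreviation "L S \<equiv> Ind r (delete_verts G (closed_nbhd G S))"

lemma sym_E: "sym E"
  using sym_arcs by (simp add: symmetric_def)

lemma supportD:
  assumes "S \<in> supports"
  shows "S \<subseteq> verts G" "v \<notin> S" "card S = r" "finite S" "S \<noteq> {}" "cut_connected E (insert v S)"
    "cut_connected E S"
proof -
  show S: "S \<subseteq> verts G" "v \<notin> S" "card S = r" "cut_connected E (insert v S)"
    using assms by (auto simp: Supp_iff[OF graph v_in])
  show "finite S" using S finite_verts finite_subset by blast
  show "S \<noteq> {}" using S r_pos by auto
  show "cut_connected E S"
    using Supp_conn assms S connected_induce_subgraph_iff[OF graph, of S]
    by (auto simp: Supp_connected_def)
qed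

lemma finite_supports: "finite supports"
  using supportD(1) finite_verts by (intro finite_subset[of supports "Pow (verts G)"]) auto

lemma in_K_iff: "A \<in> K \<longleftrightarrow> A \<subseteq> verts G \<and> (\<forall>C\<subseteq>A. cut_connected E C \<longrightarrow> card C \<le> r)"
  by (rule in_Ind_iff[OF graph])

text \<open>A connected set with more than \<open>r\<close> vertices in \<open>insert v A\<close>
  must contain \<open>v\<close>; growing from \<open>v\<close> inside it would give a support
  contained in \<open>A\<close>.\<close>

lemma insert_v_in_K:
  assumes "A \<in> K" "\<And>S. S \<in> supports \<Longrightarrow> \<not> S \<subseteq> A"
  shows "insert v A \<in> K"
  unfolding in_K_iff
proof (intro conjI allI impI)
  show A: "insert v A \<subseteq> verts G" using assms(1) v_in by (auto simp: in_K_iff)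
  fix C assume C: "C \<subseteq> insert v A" "cut_connected E C"
  show "card C \<le> r"
  proof (rule ccontr)
    assume *: "\<not> card C \<le> r"
    then have "v \<in> C" using C assms(1) by (auto simp: in_K_iff)
    moreover have "C \<subseteq> verts G" using C(1) A by (rule subset_trans)
    then have "finite C" using finite_verts by (rule finite_subset)
    ultimately obtain S where S: "S \<subseteq> C" "v \<notin> S" "card S = r" "cut_connected E (insert v S)"
      using cut_connected_grow[OF sym_E C(2), of v r] * by auto
    then have "S \<in> supports" using C A by (auto simp: Supp_iff[OF graph v_in])
    with assms(2) S C show False by blast
  qed
qed

text \<open>A vertex of \<open>A\<close> outside \<open>S\<close> but adjacent to \<open>S\<close>
  would complete \<open>S\<close> to a connected set of \<open>r + 1\<close> vertices. This is where
  connectedness of the supports enters.\<close>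

lemma support_isolated:
  assumes "S \<in> supports" "S \<subseteq> A" "A \<in> K"
  shows "A \<inter> closed_nbhd G S = S"
proof -
  have "a \<in> S" if "a \<in> A" "s \<in> S" "(s, a) \<in> E" for a s
  proof (rule ccontr)
    assume "a \<notin> S"
    then have "card (insert a S) = Suc r" using supportD[OF assms(1)] by simp
    moreover have "cut_connected E (insert a S)"
      using cut_connected_insert[OF sym_E supportD(7)[OF assms(1)]] that by blast
    moreover have "insert a S \<subseteq> A" using assms(2) that by blast
    ultimately have "Suc r \<le> r" using assms(3) unfolding in_K_iff by metis
    then show False by simp
  qed
  then show ?thesis using assms(2) by (auto simp: closed_nbhd_def nbhd_def)
qed

lemma v_nbhd_support:
  assumes "S \<in> supports"
  shows "v \<in> closed_nbhd G S" "\<exists>w\<in>S. w \<in> nbhd G {v}"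
proof -
  note S = supportD[OF assms]
  obtain w where "w \<in> S" "(v, w) \<in> E"
    using S(6)[unfolded cut_connected_def, THEN conjunct2, rule_format, of "{v}"] S(2,5) by blast
  then show "v \<in> closed_nbhd G S" "\<exists>w\<in>S. w \<in> nbhd G {v}"
    using symD[OF sym_E] v_in S(1) by (auto simp: closed_nbhd_def nbhd_def)
qed

text \<open>Some neighbour \<open>w\<close> of \<open>v\<close> lies in \<open>S'\<close>. By
  \<open>nbhd_sub\<close> it lies in the closed neighbourhood of \<open>S\<close>, and since it is
  in \<open>A\<close>, isolation puts it into \<open>S\<close>. Two connected sets sharing
  \<open>w\<close> have a connected union, which has at most \<open>r\<close> vertices and so equals
  both.\<close>

lemma support_unique:
  assumes "S \<in> supports" "S' \<in> supports" "S \<subseteq> A" "S' \<subseteq> A" "A \<in> K"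
  shows "S = S'"
proof -
  obtain w where w: "w \<in> S'" "w \<in> nbhd G {v}" using v_nbhd_support[OF assms(2)] by blast
  then have "w \<in> S" using nbhd_sub assms support_isolated[of S A] by blast
  with w have "cut_connected E (S \<union> S')"
    using cut_connected_Un[OF sym_E] assms(1,2) supportD(7) by blast
  then have "card (S \<union> S') \<le> r" using assms by (auto simp: in_K_iff)
  then show ?thesis
    using supportD(3,4)[OF assms(1)] supportD(3,4)[OF assms(2)]
    by (metis Un_upper1 Un_upper2 card_seteq finite_UnI)
qed

text \<open>Deleting vertices does not change which sets of remaining vertices are connected, so
  \<open>L S\<close> can be treated as a subcomplex of \<open>K\<close>.\<close>

lemma in_L_iff:
  assumes "S \<in> supports"
  shows "B \<in> L S \<longleftrightarrow> B \<in> K \<and> B \<inter> closed_nbhd G S = {}"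
proof -
  have "B \<in> L S \<longleftrightarrow> B \<subseteq> verts G - closed_nbhd G S \<and>
     (\<forall>C\<subseteq>B. cut_connected (Restr E (verts G - closed_nbhd G S)) C \<longrightarrow> card C \<le> r)"
    using in_Ind_iff[OF graph_delete_verts[OF graph]]
    by (simp add: delete_verts_def arcs_ends_induce_subgraph)
  moreover have "cut_connected (Restr E (verts G - closed_nbhd G S)) C \<longleftrightarrow> cut_connected E C"
    if "C \<subseteq> verts G - closed_nbhd G S" for C
    using that cut_connected_restrict[of E C]
      cut_connected_restrict[of "Restr E (verts G - closed_nbhd G S)" C]
    by (simp add: Int_assoc Times_Int_Times inf.absorb2)
  ultimately have "B \<in> L S \<longleftrightarrow> B \<subseteq> verts G - closed_nbhd G S \<and>
     (\<forall>C\<subseteq>B. cut_connected E C \<longrightarrow> card C \<le> r)"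
    by (metis (no_types, lifting) subset_trans)
  then show ?thesis
    by (auto simp: in_K_iff)
qed

text \<open>The link of \<open>S\<close> in \<open>K\<close> is \<open>L S\<close>. One direction is
  isolation. For the other, a connected subset of \<open>A\<close> that meets \<open>S\<close>
  without lying in it has an edge from \<open>S\<close> to \<open>A - S\<close>, whose end would be
  in the closed neighbourhood of \<open>S\<close>.\<close>

lemma join_in_K_iff:
  assumes "S \<in> supports" "S \<subseteq> A"
  shows "A \<in> K \<longleftrightarrow> A - S \<in> L S"
proof
  assume "A \<in> K"
  then show "A - S \<in> L S"
    using support_isolated[OF assms] Ind_subset[OF graph] by (auto simp: in_L_iff[OF assms(1)])
next
  assume "A - S \<in> L S"
  then have B: "A - S \<in> K" "(A - S) \<inter> closed_nbhd G S = {}" by (auto simp: in_L_iff[OF assms(1)])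
  show "A \<in> K"
    unfolding in_K_iff
  proof (intro conjI allI impI)
    show "A \<subseteq> verts G" using B(1) supportD(1)[OF assms(1)] by (auto simp: in_K_iff)
    fix C assume C: "C \<subseteq> A" "cut_connected E C"
    consider "C \<inter> S = {}" | "C \<subseteq> S" | "C \<inter> S \<noteq> {}" "C \<inter> S \<noteq> C" by blast
    then show "card C \<le> r"
    proof cases
      case 1
      then have "C \<subseteq> A - S" using C by blast
      then show ?thesis using C B by (auto simp: in_K_iff)
    next
      case 2
      then show ?thesis using supportD(3,4)[OF assms(1)] card_mono by fastforce
    next
      case 3
      then obtain x y where xy: "x \<in> C \<inter> S" "y \<in> C - C \<inter> S" "(x, y) \<in> E"
        using C(2)[unfolded cut_connected_def, THEN conjunct2, rule_format, of "C \<inter> S"] by blast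
      moreover have "y \<in> verts G" using xy(3) by (auto simp: arcs_ends_conv)
      ultimately show ?thesis using B(2) C(1) by (auto simp: closed_nbhd_def nbhd_def)
    qed
  qed
qed

lemma v_singleton_in_K: "{v} \<in> K"
  unfolding in_K_iff using v_in r_pos by (auto simp: subset_singleton_iff)

end

section \<open>Collapses, final topologies and wedges\<close>

text \<open>The homotopy \<open>h\<close> respects the fibres of \<open>f\<close> and its end map is
  constant on them. So \<open>h (1, x)\<close> descends to a homotopy inverse \<open>g\<close> of
  \<open>f\<close>, \<open>h\<close> itself joins the identity to \<open>g \<circ> f\<close>, and
  the map induced by \<open>h\<close> on \<open>Z\<close> joins the identity to
  \<open>f \<circ> g\<close>.\<close>

lemma collapse_homotopy_equivalent:
  assumes X: "compact_space X" and Z: "Hausdorff_space Z"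
    and f: "continuous_map X Z f" "f ` topspace X = topspace Z"
    and h: "continuous_map (prod_topology (top_of_set {0..1::real}) X) X h"
    and h0: "\<And>x. x \<in> topspace X \<Longrightarrow> h (0, x) = x"
    and fh: "\<And>t x y. \<lbrakk>t \<in> {0..1}; x \<in> topspace X; y \<in> topspace X; f x = f y\<rbrakk>
      \<Longrightarrow> f (h (t, x)) = f (h (t, y))"
    and h1: "\<And>x y. \<lbrakk>x \<in> topspace X; y \<in> topspace X; f x = f y\<rbrakk> \<Longrightarrow> h (1, x) = h (1, y)"
  shows "X homotopy_equivalent_space Z"
proof -
  let ?I = "top_of_set {0..1::real}"
  \<comment> \<open>An arbitrary section of \<open>f\<close>, in general not continuous; continuity
    of \<open>g\<close> and \<open>H\<close> comes from the quotient maps \<open>qf\<close> and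
    \<open>qI\<close>.\<close>
  define s where "s = inv_into (topspace X) f"
  have s: "s z \<in> topspace X" "f (s z) = z" if "z \<in> topspace Z" for z
    using that f(2) by (auto simp: s_def inv_into_into f_inv_into_f)
  have fZ: "f x \<in> topspace Z" if "x \<in> topspace X" for x using that f by auto
  have qf: "quotient_map X Z f"
    using continuous_imp_quotient_map[OF f(1) X Z f(2)] .
  \<comment> \<open>The product of \<open>f\<close> with the interval is again a surjection from a
    compact to a Hausdorff space, hence a quotient map.\<close>
  have "compact_space (prod_topology ?I X)"
    using X by (simp add: compact_space_prod_topology compact_space_subtopology)
  moreover have "Hausdorff_space (prod_topology ?I Z)"
    using Z by (simp add: Hausdorff_space_prod_topology Hausdorff_space_subtopology)
  moreover have "continuous_map (prod_topology ?I X) (prod_topology ?I Z) (\<lambda>(t, x). (t, f x))"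
    using f(1) by (auto simp: continuous_map_prod_top)
  moreover have "(\<lambda>(t, x). (t, f x)) ` topspace (prod_topology ?I X) = topspace (prod_topology ?I Z)"
    using f(2) by force
  ultimately have qI: "quotient_map (prod_topology ?I X) (prod_topology ?I Z) (\<lambda>(t, x). (t, f x))"
    by (intro continuous_imp_quotient_map)
  define g where "g z = h (1, s z)" for z
  have h1c: "continuous_map X X (\<lambda>x. h (1, x))"
    using continuous_map_o_Pair[OF h, of 1] by (simp add: o_def)
  have gf: "g (f x) = h (1, x)" if "x \<in> topspace X" for x
    unfolding g_def using that s fZ by (intro h1) auto
  have g: "continuous_map Z X g"
    by (rule continuous_compose_quotient_map[OF qf], rule continuous_map_eq[OF h1c]) (auto simp: gf)
  have "homotopic_with (\<lambda>x. True) X X id (g \<circ> f)"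
    by (subst homotopic_with, simp, rule exI[of _ h]) (auto simp: h h0 gf)
  then have gf_id: "homotopic_with (\<lambda>x. True) X X (g \<circ> f) id"
    by (rule homotopic_with_symD)
  define H where "H = (\<lambda>(t, z). f (h (t, s z)))"
  have Hc: "continuous_map (prod_topology ?I Z) Z H"
  proof (rule continuous_compose_quotient_map[OF qI],
      rule continuous_map_eq[OF continuous_map_compose[OF h f(1)]])
    fix p assume "p \<in> topspace (prod_topology ?I X)"
    then show "(f \<circ> h) p = (H \<circ> (\<lambda>(t, x). (t, f x))) p"
      using s fZ by (auto simp: H_def split: prod.split intro!: fh)
  qed
  have "homotopic_with (\<lambda>x. True) Z Z id (f \<circ> g)"
  proof (subst homotopic_with, simp, intro exI[of _ H] conjI ballI Hc)
  qed (auto simp: H_def h0 s g_def)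
  then have "homotopic_with (\<lambda>x. True) Z Z (f \<circ> g) id"
    by (rule homotopic_with_symD)
  with f(1) g gf_id show ?thesis
    unfolding homotopy_equivalent_space_def by blast
qed

section \<open>Continuity and compactness for final topologies, suspensions and wedges\<close>

lemma continuous_map_into_final_topology:
  "q ` topspace X \<subseteq> Y \<Longrightarrow> continuous_map X (final_topology X q Y) q"
  by (auto simp: continuous_map_def topspace_final_topology openin_final_topology)

lemma continuous_map_from_final_topology:
  assumes "q ` topspace X \<subseteq> Y" "continuous_map X Z (g \<circ> q)" "g \<in> Y \<rightarrow> topspace Z"
  shows "continuous_map (final_topology X q Y) Z g"
  unfolding continuous_map_def
proof (intro conjI allI impI)
  show "g \<in> topspace (final_topology X q Y) \<rightarrow> topspace Z"
    using assms by (simp add: topspace_final_topology)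
  fix U assume "openin Z U"
  then have "openin X {x \<in> topspace X. (g \<circ> q) x \<in> U}"
    using assms(2) by (rule openin_continuous_map_preimage[rotated])
  moreover have "{x \<in> topspace X. (g \<circ> q) x \<in> U} =
      {x \<in> topspace X. q x \<in> {y \<in> topspace (final_topology X q Y). g y \<in> U}}"
    using assms(1) by (auto simp: topspace_final_topology)
  ultimately show "openin (final_topology X q Y) {y \<in> topspace (final_topology X q Y). g y \<in> U}"
    using assms(1) by (auto simp: openin_final_topology topspace_final_topology)
qed

text \<open>Points of \<open>Y\<close> missed by \<open>q\<close> are isolated, hence the finiteness
  assumption. They occur as the poles over an empty space and as the point of an empty
  wedge.\<close>

lemma compact_space_final_topology:
  assumes "compact_space X" "q ` topspace X \<subseteq> Y" "finite (Y - q ` topspace X)"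
  shows "compact_space (final_topology X q Y)"
proof -
  have top: "topspace (final_topology X q Y) = Y"
    using assms(2) by (rule topspace_final_topology)
  have "compactin (final_topology X q Y) (q ` topspace X)"
    using image_compactin[OF _ continuous_map_into_final_topology[OF assms(2)]] assms(1)
    by (simp add: compact_space_def)
  moreover have "compactin (final_topology X q Y) (Y - q ` topspace X)"
    using assms(3) top by (intro finite_imp_compactin) auto
  ultimately have "compactin (final_topology X q Y) (q ` topspace X \<union> (Y - q ` topspace X))"
    by (rule compactin_Un)
  moreover have "q ` topspace X \<union> (Y - q ` topspace X) = Y" using assms(2) by blast
  ultimately show ?thesis by (simp add: compact_space_def top)
qed

lemma compact_space_suspension:
  assumes "compact_space X"
  shows "compact_space (suspension X)"
  unfolding suspension_def
proof (rule compact_space_final_topology)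
  show "compact_space (prod_topology X (top_of_set {0..1::real}))"
    using assms by (simp add: compact_space_prod_topology compact_space_subtopology)
qed (auto intro: finite_subset[of _ "{North, South}"])

lemma compact_space_iterated_suspension:
  assumes "compact_space X"
  shows "compact_space (iterated_suspension r X)"
proof (induction r)
  case 0
  have "compact_space (base_copy X)"
    unfolding base_copy_def using assms by (rule compact_space_final_topology) auto
  then show ?case by (simp add: iterated_suspension_def)
next
  case (Suc r)
  then show ?case by (simp add: iterated_suspension_def compact_space_suspension)
qed

lemma compact_space_sum_topology:
  assumes "finite I" "\<And>i. i \<in> I \<Longrightarrow> compact_space (X i)"
  shows "compact_space (sum_topology X I)"
proof -
  have "compactin (sum_topology X I) (Pair i ` topspace (X i))" if "i \<in> I" for i
    using image_compactin[OF _ continuous_map_component_injection[OF that]] assms(2)[OF that]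
    by (simp add: compact_space_def)
  then have "compactin (sum_topology X I) (\<Union>((\<lambda>i. Pair i ` topspace (X i)) ` I))"
    using assms(1) by (intro compactin_Union) auto
  moreover have "\<Union>((\<lambda>i. Pair i ` topspace (X i)) ` I) = topspace (sum_topology X I)"
    by auto
  ultimately show ?thesis by (simp add: compact_space_def)
qed

lemma continuous_map_from_sum_topology:
  assumes "\<And>i. i \<in> I \<Longrightarrow> continuous_map (X i) Z (\<lambda>x. f (i, x))"
  shows "continuous_map (sum_topology X I) Z f"
  unfolding continuous_map_def
proof (intro conjI allI impI)
  show "f \<in> topspace (sum_topology X I) \<rightarrow> topspace Z"
    using assms by (fastforce simp: continuous_map_def)
  fix U assume U: "openin Z U"
  have "openin (X i) {x. (i, x) \<in> {x \<in> topspace (sum_topology X I). f x \<in> U}}" if "i \<in> I" for i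
    using openin_continuous_map_preimage[OF assms[OF that] U] that by simp
  then show "openin (sum_topology X I) {x \<in> topspace (sum_topology X I). f x \<in> U}"
    by (auto simp: openin_sum_topology)
qed

lemma compact_space_wedge:
  assumes "finite I" "\<And>i. i \<in> I \<Longrightarrow> compact_space (X i)"
  shows "compact_space (wedge I X p)"
  unfolding wedge_def
  by (rule compact_space_final_topology)
    (use assms in \<open>auto simp: compact_space_sum_topology intro: finite_subset[of _ "{None}"]\<close>)

section \<open>Signed joins and iterated suspensions\<close>

text \<open>
  The join of the octahedral sphere with vertices \<open>\<plusminus>s\<close>, \<open>s \<in> S\<close>, and a complex \<open>L\<close>: a negative
  coordinate at \<open>s\<close> is a weight on the vertex \<open>-s\<close>.
\<close>

definition signed_join :: "'a set \<Rightarrow> 'a set \<Rightarrow> 'a set set \<Rightarrow> ('a \<Rightarrow> real) set" where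
  "signed_join V S L = {x. (\<forall>a. a \<notin> V \<longrightarrow> x a = 0) \<and> (\<forall>a. a \<notin> S \<longrightarrow> 0 \<le> x a) \<and>
     {a. a \<notin> S \<and> x a \<noteq> 0} \<in> L \<and> (\<Sum>a\<in>V. \<bar>x a\<bar>) = 1}"

text \<open>With no signed vertices the join is the ordinary realization, so that \<open>K\<close>
  and the suspensions share one kind of coordinates.\<close>

lemma realization_eq_signed_join:
  assumes "finite V" "\<And>A. A \<in> K \<Longrightarrow> A \<subseteq> V"
  shows "realization K = top_of_set (signed_join V {} K)"
proof -
  have "{x. (\<forall>a. 0 \<le> x a) \<and> {a. x a \<noteq> 0} \<in> K \<and> (\<Sum>a | x a \<noteq> 0. x a) = 1} = signed_join V {} K"
    (is "?A = ?B")
  proof (intro set_eqI)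
    fix x :: "'a \<Rightarrow> real"
    have "(\<Sum>a | x a \<noteq> 0. x a) = (\<Sum>a\<in>V. \<bar>x a\<bar>)" if "\<And>a. 0 \<le> x a" "{a. x a \<noteq> 0} \<subseteq> V"
      using that assms(1) by (intro sum.mono_neutral_cong_left) auto
    then show "x \<in> ?A \<longleftrightarrow> x \<in> ?B"
      using assms(2)[of "{a. x a \<noteq> 0}"] by (auto simp: signed_join_def)
  qed
  then show ?thesis
    by (simp add: realization_def euclidean_product_topology)
qed

lemma Hausdorff_space_fun: "Hausdorff_space (top_of_set (T :: ('a \<Rightarrow> real) set))"
proof -
  have "Hausdorff_space (euclidean :: ('a \<Rightarrow> real) topology)"
    by (subst euclidean_product_topology[symmetric])
      (simp add: Hausdorff_space_product_topology)
  then show ?thesis by (rule Hausdorff_space_subtopology)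
qed

lemma continuous_on_coordinate: "continuous_on T (\<lambda>x. x a :: real)"
  by (rule continuous_on_subset[OF continuous_on_product_coordinates subset_UNIV])

lemma compact_space_realization:
  assumes V: "finite V" "\<And>A. A \<in> K \<Longrightarrow> A \<subseteq> V" and sub: "\<And>A B. A \<in> K \<Longrightarrow> B \<subseteq> A \<Longrightarrow> B \<in> K"
  shows "compact_space (realization K)"
proof -
  \<comment> \<open>The closed simplex on \<open>A\<close>: a closed subset of the cube, which is
    compact by Tychonoff. The realization is a finite union of these.\<close>
  define F where "F A = {x \<in> PiE UNIV (\<lambda>_. {0..1::real}). (\<forall>a. a \<in> A \<or> x a = 0) \<and> (\<Sum>a\<in>V. x a) = 1}" for A
  have "compactin (powertop_real UNIV) (PiE UNIV (\<lambda>_::'a. {0..1::real}))"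
    by (subst compactin_PiE) auto
  then have "compact (PiE UNIV (\<lambda>_::'a. {0..1::real}))"
    by (simp add: euclidean_product_topology)
  moreover have "closed {x :: 'a \<Rightarrow> real. (\<forall>a. a \<in> A \<or> x a = 0) \<and> (\<Sum>a\<in>V. x a) = 1}" for A
    by (intro closed_Collect_conj closed_Collect_all closed_Collect_disj closed_Collect_const closed_Collect_eq continuous_intros
        continuous_on_coordinate)
  ultimately have "compact (PiE UNIV (\<lambda>_::'a. {0..1::real}) \<inter>
      {x. (\<forall>a. a \<in> A \<or> x a = 0) \<and> (\<Sum>a\<in>V. x a) = 1})" for A
    by (rule compact_Int_closed)
  moreover have "F A = PiE UNIV (\<lambda>_::'a. {0..1::real}) \<inter>
      {x. (\<forall>a. a \<in> A \<or> x a = 0) \<and> (\<Sum>a\<in>V. x a) = 1}" for A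
    by (auto simp: F_def)
  ultimately have F: "compact (F A)" for A
    by simp
  have "finite K" using V by (meson PowI finite_Pow_iff finite_subset subsetI)
  then have "compact (\<Union>A\<in>K. F A)"
    using F by (intro compact_UN) auto
  also have "(\<Union>A\<in>K. F A) = signed_join V {} K"
  proof (intro equalityI subsetI)
    fix x assume "x \<in> (\<Union>A\<in>K. F A)"
    then obtain A where A: "A \<in> K" "x \<in> F A" by blast
    then have "{a. x a \<noteq> 0} \<subseteq> A" "\<And>a. 0 \<le> x a" by (auto simp: F_def PiE_iff)
    with A V sub[of A "{a. x a \<noteq> 0}"] show "x \<in> signed_join V {} K"
      by (force simp: F_def signed_join_def)
  next
    fix x assume x: "x \<in> signed_join V {} K"
    then have nn: "\<And>a. 0 \<le> x a" and sum: "(\<Sum>a\<in>V. x a) = 1" and K: "{a. x a \<noteq> 0} \<in> K"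
      and out: "\<And>a. a \<notin> V \<Longrightarrow> x a = 0"
      by (auto simp: signed_join_def)
    have "x a \<le> 1" for a
      using member_le_sum[of a V x] nn sum out[of a] V(1) by (cases "a \<in> V") auto
    with nn sum K show "x \<in> (\<Union>A\<in>K. F A)"
      by (auto simp: F_def intro!: bexI[OF _ K])
  qed
  finally show ?thesis
    using realization_eq_signed_join[of V K] V
    by (simp add: compact_space_subtopology)
qed

text \<open>One suspension adds the pair of antipodal vertices \<open>b\<close> and
  \<open>-b\<close>, as images of \<open>South\<close> and \<open>North\<close>. The assumption
  \<open>{} \<in> L\<close> puts both into the join. A continuous injection suffices here, because
  compactness later makes the whole identification a homeomorphism.\<close>

lemma suspension_coordinates:
  fixes \<theta> :: "'b susp_point \<Rightarrow> 'a \<Rightarrow> real"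
  assumes V: "finite V" "b \<in> V" and b: "b \<notin> S" "\<And>A. A \<in> L \<Longrightarrow> b \<notin> A" and empty: "{} \<in> L"
    and \<theta>: "continuous_map Y euclidean \<theta>" "inj_on \<theta> (topspace Y)"
      "\<theta> ` topspace Y = signed_join V S L"
  shows "\<exists>\<theta>'. continuous_map (suspension Y) euclidean \<theta>' \<and> inj_on \<theta>' (topspace (suspension Y)) \<and>
    \<theta>' ` topspace (suspension Y) = signed_join V (insert b S) L \<and>
    \<theta>' North = (\<lambda>a. if a = b then - 1 else 0)"
proof -
  \<comment> \<open>At height \<open>t\<close> the \<open>b\<close>-coordinate is
    \<open>1 - 2 * t\<close>, and the coordinates of \<open>y\<close> are scaled so that the
    absolute values still sum to 1. At the poles the scale is 0, so one formula covers all of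
    \<open>susp_proj\<close>. \<open>Base\<close> points do not occur in a suspension.\<close>
  define \<theta>' where "\<theta>' p = (case p of Base _ \<Rightarrow> undefined
    | North \<Rightarrow> (\<lambda>a. if a = b then - 1 else 0)
    | South \<Rightarrow> (\<lambda>a. if a = b then 1 else 0)
    | Meridian y t \<Rightarrow> (\<lambda>a. (1 - \<bar>2 * t - 1\<bar>) * \<theta> y a + (if a = b then 1 - 2 * t else 0)))" for p
  have \<theta>J: "\<theta> y \<in> signed_join V S L" if "y \<in> topspace Y" for y
    using that \<theta>(3) by blast
  have zero_b: "x b = 0" if "x \<in> signed_join V S L" for x
    using that b by (auto simp: signed_join_def)
  have proj: "\<theta>' (susp_proj (y, t)) = (\<lambda>a. (1 - \<bar>2 * t - 1\<bar>) * \<theta> y a + (if a = b then 1 - 2 * t else 0))"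
    for y t
    by (auto simp: susp_proj_def \<theta>'_def fun_eq_iff)
  have top: "topspace (suspension Y) =
      {North, South} \<union> {Meridian y t | y t. y \<in> topspace Y \<and> 0 < t \<and> t < 1}" (is "_ = ?M")
  proof
    show "topspace (suspension Y) \<subseteq> ?M"
      by (auto simp: topspace_suspension susp_proj_def)
    have "Meridian y t \<in> susp_proj ` (topspace Y \<times> {0..1})" if "y \<in> topspace Y" "0 < t" "t < 1" for y t
      by (rule image_eqI[of _ _ "(y, t)"]) (use that in \<open>auto simp: susp_proj_def\<close>)
    then show "?M \<subseteq> topspace (suspension Y)"
      by (auto simp: topspace_suspension)
  qed
  have cont: "continuous_map (suspension Y) euclidean \<theta>'"
    unfolding suspension_def
  proof (rule continuous_map_from_final_topology)
    let ?P = "prod_topology Y (top_of_set {0..1::real})"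
    have "continuous_map ?P euclideanreal (\<lambda>p. \<theta> (fst p) a)" for a
    proof -
      have "continuous_map Y (powertop_real UNIV) \<theta>"
        using \<theta>(1) by (simp add: euclidean_product_topology)
      then have "continuous_map Y euclideanreal (\<lambda>y. \<theta> y a)"
        by (auto simp: continuous_map_componentwise_UNIV)
      from continuous_map_compose[OF continuous_map_fst this] show ?thesis by (simp add: o_def)
    qed
    moreover have "continuous_map ?P euclideanreal snd"
      using continuous_map_snd[of Y "top_of_set {0..1::real}"]
      by (rule continuous_map_into_fulltopology)
    ultimately have "continuous_map ?P euclideanreal
        (\<lambda>p. (1 - \<bar>2 * snd p - 1\<bar>) * \<theta> (fst p) a + (if a = b then 1 - 2 * snd p else 0))" for a
      by (cases "a = b") (auto intro!: continuous_intros)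
    moreover have "(\<theta>' \<circ> susp_proj) =
        (\<lambda>p a. (1 - \<bar>2 * snd p - 1\<bar>) * \<theta> (fst p) a + (if a = b then 1 - 2 * snd p else 0))"
      by (intro ext) (auto simp: proj)
    ultimately show "continuous_map ?P euclidean (\<theta>' \<circ> susp_proj)"
      by (subst euclidean_product_topology[symmetric])
        (simp only: continuous_map_componentwise_UNIV, simp)
  qed auto
  have inj: "inj_on \<theta>' (topspace (suspension Y))"
  proof (rule inj_onI)
    fix p q assume pq: "p \<in> topspace (suspension Y)" "q \<in> topspace (suspension Y)" "\<theta>' p = \<theta>' q"
    \<comment> \<open>The \<open>b\<close>-coordinate determines the height; strictly between the
      poles the scale is nonzero, so \<open>\<theta> y\<close> can then be recovered.\<close>
    have bcoord: "\<theta>' North b = - 1" "\<theta>' South b = 1"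
        "\<And>y t. y \<in> topspace Y \<Longrightarrow> \<theta>' (Meridian y t) b = 1 - 2 * t"
      using zero_b[OF \<theta>J] by (auto simp: \<theta>'_def)
    have mer: "Meridian y t = Meridian z u"
      if yz: "y \<in> topspace Y" "z \<in> topspace Y" "0 < t" "t < 1"
        and eq: "\<theta>' (Meridian y t) = \<theta>' (Meridian z u)" for y z t u
    proof -
      have "1 - 2 * t = 1 - 2 * u" using bcoord(3)[of y t] bcoord(3)[of z u] yz eq by simp
      then have tu: "t = u" by simp
      have "\<theta> y a = \<theta> z a" for a
      proof -
        have "(1 - \<bar>2 * t - 1\<bar>) * \<theta> y a = (1 - \<bar>2 * t - 1\<bar>) * \<theta> z a"
          using fun_cong[OF eq, of a] tu by (auto simp: \<theta>'_def)
        moreover have "1 - \<bar>2 * t - 1\<bar> \<noteq> 0" using yz(3,4) by (auto simp: abs_if)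
        ultimately show ?thesis by simp
      qed
      then have "\<theta> y = \<theta> z" by blast
      with yz \<theta>(2) tu show ?thesis by (auto dest: inj_onD)
    qed
    have poles: "\<theta>' (Meridian y t) \<noteq> \<theta>' North" "\<theta>' (Meridian y t) \<noteq> \<theta>' South"
      if "y \<in> topspace Y" "0 < t" "t < 1" for y t
      using bcoord that by (auto dest!: fun_cong[of _ _ b])
    have NS: "\<theta>' North \<noteq> \<theta>' South"
      using bcoord(1,2) by (auto dest!: fun_cong[of _ _ b])
    from pq(1,2) consider "p = North \<or> p = South" "q = North \<or> q = South"
      | y t where "p = North \<or> p = South" "q = Meridian y t" "y \<in> topspace Y" "0 < t" "t < 1"
      | y t where "q = North \<or> q = South" "p = Meridian y t" "y \<in> topspace Y" "0 < t" "t < 1"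
      | y t z u where "p = Meridian y t" "y \<in> topspace Y" "0 < t" "t < 1" "q = Meridian z u" "z \<in> topspace Y"
      unfolding top by blast
    then show "p = q"
      using pq(3) mer poles NS by cases metis+
  qed
  have sum_split: "(\<Sum>a\<in>V. \<bar>x a\<bar>) = (\<Sum>a\<in>V - {b}. \<bar>x a\<bar>) + \<bar>x b\<bar>" for x :: "'a \<Rightarrow> real"
    using V by (simp add: sum.remove)
  have into: "\<theta>' ` topspace (suspension Y) \<subseteq> signed_join V (insert b S) L"
  proof
    fix x assume "x \<in> \<theta>' ` topspace (suspension Y)"
    then consider "x = \<theta>' North" | "x = \<theta>' South"
      | y t where "x = \<theta>' (Meridian y t)" "y \<in> topspace Y" "0 < t" "t < 1"
      unfolding top by blast
    then show "x \<in> signed_join V (insert b S) L"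
    proof cases
      case 1
      then show ?thesis using V empty by (auto simp: signed_join_def \<theta>'_def sum_split cong: conj_cong)
    next
      case 2
      then show ?thesis using V empty by (auto simp: signed_join_def \<theta>'_def sum_split cong: conj_cong)
    next
      case 3
      define c where "c = 1 - \<bar>2 * t - 1\<bar>"
      have c: "c > 0" "c + \<bar>1 - 2 * t\<bar> = 1" using 3 by (auto simp: c_def abs_if)
      note y = \<theta>J[OF 3(2), unfolded signed_join_def mem_Collect_eq] zero_b[OF \<theta>J[OF 3(2)]]
      have x: "x a = (if a = b then 1 - 2 * t else c * \<theta> y a)" for a
        using 3(1) y(2) by (auto simp: \<theta>'_def c_def)
      have "(\<Sum>a\<in>V - {b}. \<bar>x a\<bar>) = (\<Sum>a\<in>V - {b}. c * \<bar>\<theta> y a\<bar>)"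
        using c by (intro sum.cong) (auto simp: x abs_mult)
      also have "\<dots> = c * (\<Sum>a\<in>V. \<bar>\<theta> y a\<bar>)"
        using y(2) by (simp add: sum_split sum_distrib_left)
      finally have "(\<Sum>a\<in>V - {b}. \<bar>x a\<bar>) = c" using y by simp
      then have "(\<Sum>a\<in>V. \<bar>x a\<bar>) = 1"
        unfolding sum_split[of x] using c x[of b] by simp
      moreover have "{a. a \<notin> insert b S \<and> x a \<noteq> 0} = {a. a \<notin> S \<and> \<theta> y a \<noteq> 0}"
        using c y(2) by (auto simp: x)
      ultimately show ?thesis
        using y V c unfolding signed_join_def by (auto simp: x)
    qed
  qed
  have onto: "signed_join V (insert b S) L \<subseteq> \<theta>' ` topspace (suspension Y)"
  proof
    fix x assume "x \<in> signed_join V (insert b S) L"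
    note x = this[unfolded signed_join_def mem_Collect_eq]
    have s: "(\<Sum>a\<in>V - {b}. \<bar>x a\<bar>) = 1 - \<bar>x b\<bar>" using x sum_split[of x] by simp
    have nn: "(\<Sum>a\<in>V - {b}. \<bar>x a\<bar>) \<ge> 0" by (simp add: sum_nonneg)
    show "x \<in> \<theta>' ` topspace (suspension Y)"
    proof (cases "\<bar>x b\<bar> = 1")
      case True
      then have "\<forall>a\<in>V - {b}. \<bar>x a\<bar> = 0"
        using s V by (subst sum_nonneg_eq_0_iff[symmetric]) auto
      then have z: "x a = 0" if "a \<noteq> b" for a using x that by (cases "a \<in> V") auto
      have "x = \<theta>' North \<or> x = \<theta>' South"
        using True z by (auto simp: \<theta>'_def fun_eq_iff abs_if split: if_splits)
      then show ?thesis unfolding top by blast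
    next
      case False
      then have c: "1 - \<bar>x b\<bar> > 0" using s nn by linarith
      \<comment> \<open>Away from the two new vertices, dropping the \<open>b\<close>-coordinate and
        rescaling gives the point of the join below, and \<open>t\<close> solves
        \<open>1 - 2 * t = x b\<close>.\<close>
      define y where "y a = (if a = b then 0 else x a / (1 - \<bar>x b\<bar>))" for a
      have "(\<Sum>a\<in>V. \<bar>y a\<bar>) = (\<Sum>a\<in>V - {b}. \<bar>x a\<bar> / (1 - \<bar>x b\<bar>))"
        using c by (simp add: sum_split y_def)
      also have "\<dots> = 1" using s c by (simp flip: sum_divide_distrib)
      finally have "(\<Sum>a\<in>V. \<bar>y a\<bar>) = 1" .
      moreover have "{a. a \<notin> S \<and> y a \<noteq> 0} = {a. a \<notin> insert b S \<and> x a \<noteq> 0}"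
        using c by (auto simp: y_def)
      ultimately have "y \<in> signed_join V S L"
        using x c by (auto simp: signed_join_def y_def)
      then have "y \<in> \<theta> ` topspace Y" by (simp only: \<theta>(3))
      then obtain z where z: "z \<in> topspace Y" "\<theta> z = y" by (elim imageE) simp
      define t where "t = (1 - x b) / 2"
      have t: "0 < t" "t < 1" "1 - 2 * t = x b" "1 - \<bar>2 * t - 1\<bar> = 1 - \<bar>x b\<bar>"
        using c by (simp_all add: t_def field_simps)
      have "x = \<theta>' (Meridian z t)"
        using c by (auto simp: \<theta>'_def z t(3,4) y_def fun_eq_iff)
      then show ?thesis using z t unfolding top by blast
    qed
  qed
  show ?thesis
    using cont inj into onto by (intro exI[of _ \<theta>']) (auto simp: \<theta>'_def)
qed

text \<open>The enumeration \<open>s\<close> fixes the order in which the vertices are suspended.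
  The last one is \<open>s (r - 1)\<close>, so \<open>North\<close> becomes its negative; for
  \<open>r = 0\<close> there is no pole.\<close>

lemma iterated_suspension_coordinates:
  fixes s :: "nat \<Rightarrow> 'a"
  assumes V: "finite V" "\<And>A. A \<in> L \<Longrightarrow> A \<subseteq> V" and empty: "{} \<in> L"
    and s: "inj_on s {..<r}" "s ` {..<r} \<subseteq> V" "\<And>A. A \<in> L \<Longrightarrow> A \<inter> s ` {..<r} = {}"
  shows "\<exists>\<theta>. continuous_map (iterated_suspension r (realization L)) euclidean \<theta> \<and>
    inj_on \<theta> (topspace (iterated_suspension r (realization L))) \<and>
    \<theta> ` topspace (iterated_suspension r (realization L)) = signed_join V (s ` {..<r}) L \<and>
    (1 \<le> r \<longrightarrow> \<theta> North = (\<lambda>a. if a = s (r - 1) then - 1 else 0))"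
  using s
proof (induction r)
  case 0
  define \<theta> where "\<theta> p = (case p of Base x \<Rightarrow> x | _ \<Rightarrow> undefined)" for p :: "('a \<Rightarrow> real) susp_point"
  have R: "realization L = top_of_set (signed_join V {} L)"
    using realization_eq_signed_join V by blast
  have top: "topspace (base_copy (realization L)) = Base ` signed_join V {} L"
    using homeomorphic_imp_surjective_map[OF homeomorphic_map_base_copy[of "realization L"]] R by simp
  have "continuous_map (base_copy (realization L)) euclidean \<theta>"
    unfolding base_copy_def
    by (rule continuous_map_from_final_topology) (auto simp: R o_def \<theta>_def)
  moreover have "inj_on \<theta> (topspace (base_copy (realization L)))"
    "\<theta> ` topspace (base_copy (realization L)) = signed_join V {} L"
    unfolding top by (auto simp: \<theta>_def inj_on_def image_image)
  ultimately show ?case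
    by (intro exI[of _ \<theta>]) (auto simp: iterated_suspension_def)
next
  case (Suc r)
  have "\<And>A. A \<in> L \<Longrightarrow> A \<inter> s ` {..<r} = {}" using Suc.prems(3) by force
  then obtain \<theta> where \<theta>: "continuous_map (iterated_suspension r (realization L)) euclidean \<theta>"
    "inj_on \<theta> (topspace (iterated_suspension r (realization L)))"
    "\<theta> ` topspace (iterated_suspension r (realization L)) = signed_join V (s ` {..<r}) L"
    using Suc by (force simp: lessThan_Suc)
  have "s r \<notin> s ` {..<r}" using Suc.prems(1) by (auto simp: lessThan_Suc)
  moreover have "s r \<in> V" "\<And>A. A \<in> L \<Longrightarrow> s r \<notin> A" using Suc.prems by auto
  ultimately have "\<exists>\<theta>'. continuous_map (suspension (iterated_suspension r (realization L))) euclidean \<theta>' \<and>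
    inj_on \<theta>' (topspace (suspension (iterated_suspension r (realization L)))) \<and>
    \<theta>' ` topspace (suspension (iterated_suspension r (realization L))) =
      signed_join V (insert (s r) (s ` {..<r})) L \<and>
    \<theta>' North = (\<lambda>a. if a = s r then - 1 else 0)"
    using V(1) empty \<theta> by (intro suspension_coordinates)
  then show ?case by (simp add: iterated_suspension_def lessThan_Suc)
qed

section \<open>Contracting the complement of a facet\<close>

text \<open>For finite nonempty \<open>S\<close>, positive exactly where all coordinates in
  \<open>S\<close> are positive, that is, on the open star of the facet \<open>S\<close>; negative
  vertices make it 0.\<close>

definition bump :: "'a set \<Rightarrow> ('a \<Rightarrow> real) \<Rightarrow> real" where
  "bump S x = max 0 (Min (x ` S))"

lemma bump_nonneg: "0 \<le> bump S x"
  by (simp add: bump_def)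

lemma bump_le:
  assumes "finite S" "s \<in> S" "0 < bump S x"
  shows "bump S x \<le> x s"
  using assms by (auto simp: bump_def max_def split: if_splits)

lemma bump_attained:
  assumes "finite S" "S \<noteq> {}"
  obtains s where "s \<in> S" "x s \<le> bump S x"
proof -
  have "Min (x ` S) \<in> x ` S" using assms by simp
  then show ?thesis using that by (auto simp: bump_def)
qed

lemma bump_eq_0:
  assumes "finite S" "s \<in> S" "x s \<le> 0"
  shows "bump S x = 0"
  using bump_le[OF assms(1,2), of x] bump_nonneg[of S x] assms(3) by force

lemma bump_pos_iff:
  assumes "finite S" "S \<noteq> {}"
  shows "0 < bump S x \<longleftrightarrow> (\<forall>s\<in>S. 0 < x s)"
  using assms by (simp add: bump_def less_max_iff_disj)

lemma continuous_on_Min: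
  fixes f :: "'b::topological_space \<Rightarrow> 'a \<Rightarrow> real"
  assumes "finite S" "S \<noteq> {}" "\<And>s. s \<in> S \<Longrightarrow> continuous_on T (\<lambda>p. f p s)"
  shows "continuous_on T (\<lambda>p. Min (f p ` S))"
  using assms
proof (induction S rule: finite_ne_induct)
  case (singleton s)
  then show ?case by simp
next
  case (insert s S)
  have "continuous_on T (\<lambda>p. min (f p s) (Min (f p ` S)))"
    using insert by (intro continuous_on_min) auto
  then show ?case using insert by simp
qed

lemma continuous_on_bump:
  assumes "finite S" "S \<noteq> {}" "\<And>s. s \<in> S \<Longrightarrow> continuous_on T (\<lambda>p. f p s)"
  shows "continuous_on T (\<lambda>p. bump S (f p))"
  unfolding bump_def using assms by (intro continuous_on_max continuous_on_const continuous_on_Min)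

text \<open>Radial projection onto the unit sphere of the l1 norm, so that a flow only has to avoid
  the origin and to keep signs and carriers admissible.\<close>

definition normalise :: "'a set \<Rightarrow> ('a \<Rightarrow> real) \<Rightarrow> 'a \<Rightarrow> real" where
  "normalise V y a = y a / (\<Sum>b\<in>V. \<bar>y b\<bar>)"

lemma normalise_id: "(\<Sum>b\<in>V. \<bar>y b\<bar>) = 1 \<Longrightarrow> normalise V y = y"
  by (simp add: normalise_def fun_eq_iff)

lemma sum_abs_normalise:
  assumes "0 < (\<Sum>b\<in>V. \<bar>y b\<bar>)"
  shows "(\<Sum>a\<in>V. \<bar>normalise V y a\<bar>) = 1"
  using assms by (simp add: normalise_def flip: sum_divide_distrib)

lemma normalise_in_signed_join:
  assumes "0 < (\<Sum>b\<in>V. \<bar>y b\<bar>)" "\<And>a. a \<notin> V \<Longrightarrow> y a = 0" "\<And>a. a \<notin> S \<Longrightarrow> 0 \<le> y a"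
    and "{a. a \<notin> S \<and> y a \<noteq> 0} \<in> L"
  shows "normalise V y \<in> signed_join V S L"
proof -
  have "{a. a \<notin> S \<and> normalise V y a \<noteq> 0} = {a. a \<notin> S \<and> y a \<noteq> 0}"
    using assms(1) by (auto simp: normalise_def)
  then show ?thesis
    using assms sum_abs_normalise[OF assms(1)] by (auto simp: signed_join_def normalise_def)
qed

lemma continuous_on_normalise:
  assumes "\<And>a. continuous_on T (\<lambda>p. f p a)" "\<And>p. p \<in> T \<Longrightarrow> 0 < (\<Sum>b\<in>V. \<bar>f p b\<bar>)"
  shows "continuous_on T (\<lambda>p. normalise V (f p) a)"
  unfolding normalise_def
  by (intro continuous_intros assms(1)) (use assms(2) in force)

text \<open>
  The part of \<open>signed_join V S L\<close> outside the open facet spanned by \<open>S\<close> is contracted to the vertex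
  \<open>-p\<close>: moving towards \<open>-p\<close> in a straight line would run through the origin at the vertex \<open>p\<close>, and
  the last term avoids this. On the facet, \<open>d\<close> first shrinks the coordinates down to its boundary,
  and \<open>\<tau>\<close> delays the contraction accordingly.
\<close>

definition octa_flow :: "'a set \<Rightarrow> 'a \<Rightarrow> real \<Rightarrow> ('a \<Rightarrow> real) \<Rightarrow> 'a \<Rightarrow> real" where
  "octa_flow S p t x a =
    (let d = min (bump S x) (t / (2 * real (card S))); \<tau> = max 0 (t - 2 * real (card S) * bump S x)
     in (1 - \<tau>) * (x a - (if a \<in> S then d else 0)) - (if a = p then \<tau> else 0)
        - (if a \<in> S then \<tau> * (1 - \<tau>) * max 0 (x p - d) else 0))"

section \<open>Properties of the octahedral flow\<close>

context
  fixes V S :: "'a set" and p :: 'a and L :: "'a set set"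
  assumes finite_ground: "finite V" and facet_subset: "S \<subseteq> V" and apex_in_facet: "p \<in> S" and empty_in_link: "{} \<in> L"
begin

lemma finite_facet: "finite S" and facet_nonempty: "S \<noteq> {}" and card_facet_pos: "0 < real (card S)"
proof -
  show f: "finite S" using finite_ground facet_subset finite_subset by blast
  show "S \<noteq> {}" using apex_in_facet by blast
  then show "0 < real (card S)" using f by (simp add: card_gt_0_iff)
qed

text \<open>Before the contraction starts (\<open>\<tau> = 0\<close>) only weight at most
  \<open>t / 2\<close> has been removed; at \<open>\<tau> = 1\<close> the coordinate at
  \<open>p\<close> is \<open>-1\<close>; in between, the correction term keeps the flow away from
  the origin.\<close>

lemma octa_flow_nonzero:
  assumes x: "x \<in> signed_join V S L" and t: "0 \<le> t" "t \<le> 1"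
  shows "0 < (\<Sum>a\<in>V. \<bar>octa_flow S p t x a\<bar>)"
proof (rule ccontr)
  assume "\<not> 0 < (\<Sum>a\<in>V. \<bar>octa_flow S p t x a\<bar>)"
  then have "(\<Sum>a\<in>V. \<bar>octa_flow S p t x a\<bar>) = 0"
    by (intro antisym) (auto simp: sum_nonneg)
  then have "\<forall>a\<in>V. \<bar>octa_flow S p t x a\<bar> = 0"
    using finite_ground by (subst sum_nonneg_eq_0_iff[symmetric]) auto
  then have z: "octa_flow S p t x a = 0" if "a \<in> V" for a using that by simp
  define m where "m = bump S x"
  define d where "d = min m (t / (2 * real (card S)))"
  define \<tau> where "\<tau> = max 0 (t - 2 * real (card S) * m)"
  have flow: "octa_flow S p t x a = (1 - \<tau>) * (x a - (if a \<in> S then d else 0)) -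
      (if a = p then \<tau> else 0) - (if a \<in> S then \<tau> * (1 - \<tau>) * max 0 (x p - d) else 0)" for a
    by (simp add: octa_flow_def Let_def m_def d_def \<tau>_def)
  have m0: "0 \<le> m" by (simp add: m_def bump_nonneg)
  have d0: "0 \<le> d" using m0 t by (simp add: d_def)
  have "0 \<le> 2 * real (card S) * m" using m0 by simp
  then have "t - 2 * real (card S) * m \<le> 1" using t by linarith
  then have \<tau>01: "0 \<le> \<tau>" "\<tau> \<le> 1" by (auto simp: \<tau>_def)
  show False
  proof (cases "\<tau> = 0")
    case True
    then have xd: "x a = (if a \<in> S then d else 0)" if "a \<in> V" for a
      using z[OF that] by (simp add: flow split: if_splits)
    have "(\<Sum>a\<in>V. \<bar>x a\<bar>) = (\<Sum>a\<in>V. if a \<in> S then d else 0)"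
      using d0 by (intro sum.cong) (auto simp: xd)
    also have "\<dots> = (\<Sum>a\<in>S. d)"
      using finite_ground facet_subset by (intro sum.mono_neutral_cong_right) auto
    also have "\<dots> = card S * d"
      by simp
    also have "\<dots> \<le> card S * (t / (2 * real (card S)))"
      by (intro mult_left_mono) (auto simp: d_def)
    also have "\<dots> = t / 2" using card_facet_pos by simp
    finally show False using x t by (simp add: signed_join_def)
  next
    case False
    \<comment> \<open>The contraction starts only after \<open>d\<close> has reached the full
      minimum \<open>m\<close>.\<close>
    then have "2 * real (card S) * m < t" using \<tau>01 by (auto simp: \<tau>_def)
    then have dm: "d = m" using card_facet_pos by (simp add: d_def field_simps)
    show False
    proof (cases "\<tau> = 1")
      case True
      then show False using z[of p] apex_in_facet facet_subset by (auto simp: flow)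
    next
      case \<tau>1: False
      \<comment> \<open>If the coordinate at \<open>p\<close> vanishes, then \<open>x p > d\<close>
        and the correction term is positive. Vanishing at every \<open>s\<close> in \<open>S\<close>
        then forces \<open>x s > d\<close>, which fails where the minimum \<open>m = d\<close> is
        attained.\<close>
      have "(1 - \<tau>) * (x p - d) = \<tau> + \<tau> * (1 - \<tau>) * max 0 (x p - d)"
        using z[of p] apex_in_facet facet_subset by (auto simp: flow)
      moreover have "0 \<le> \<tau> * (1 - \<tau>) * max 0 (x p - d)"
        using \<tau>01 by simp
      ultimately have "0 < (1 - \<tau>) * (x p - d)" using False \<tau>01 by linarith
      then have xp: "0 < x p - d" using \<tau>01 by (simp add: zero_less_mult_iff)
      obtain s where s: "s \<in> S" "x s \<le> m" using bump_attained[OF finite_facet facet_nonempty] by (auto simp: m_def)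
      have "(1 - \<tau>) * (x s - d) = (if s = p then \<tau> else 0) + \<tau> * (1 - \<tau>) * max 0 (x p - d)"
        using z[of s] s facet_subset by (auto simp: flow)
      moreover have "0 < \<tau> * (1 - \<tau>) * max 0 (x p - d)"
        using xp False \<tau>1 \<tau>01 by simp
      ultimately have "0 < (1 - \<tau>) * (x s - d)" using \<tau>01 by (auto split: if_splits)
      then have "0 < x s - d" using \<tau>01 by (simp add: zero_less_mult_iff)
      with s dm show False by simp
    qed
  qed
qed

text \<open>Outside \<open>S\<close> the flow only multiplies by \<open>1 - \<tau>\<close>, so the
  carrier in the link stays or becomes empty.\<close>

lemma octa_flow_in:
  assumes x: "x \<in> signed_join V S L" and t: "0 \<le> t" "t \<le> 1"
  shows "normalise V (octa_flow S p t x) \<in> signed_join V S L"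
proof (rule normalise_in_signed_join[OF octa_flow_nonzero[OF assms]])
  define \<tau> where "\<tau> = max 0 (t - 2 * real (card S) * bump S x)"
  have "0 \<le> 2 * real (card S) * bump S x" by (simp add: bump_nonneg)
  then have "t - 2 * real (card S) * bump S x \<le> 1" using t by linarith
  then have \<tau>: "\<tau> \<le> 1" by (simp add: \<tau>_def)
  have out: "octa_flow S p t x a = (1 - \<tau>) * x a" if "a \<notin> S" for a
    using that apex_in_facet by (auto simp: octa_flow_def Let_def \<tau>_def)
  show "octa_flow S p t x a = 0" if "a \<notin> V" for a
    using that facet_subset x out[of a] by (auto simp: signed_join_def)
  show "0 \<le> octa_flow S p t x a" if "a \<notin> S" for a
    using that x out[of a] \<tau> by (auto simp: signed_join_def)
  have "{a. a \<notin> S \<and> octa_flow S p t x a \<noteq> 0} = (if \<tau> = 1 then {} else {a. a \<notin> S \<and> x a \<noteq> 0})"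
    by (auto simp: out cong: conj_cong)
  then show "{a. a \<notin> S \<and> octa_flow S p t x a \<noteq> 0} \<in> L"
    using x empty_in_link by (auto simp: signed_join_def)
qed

lemma octa_flow_0:
  assumes "x \<in> signed_join V S L"
  shows "normalise V (octa_flow S p 0 x) = x"
proof -
  have "octa_flow S p 0 x = x"
    by (auto simp: octa_flow_def Let_def fun_eq_iff bump_nonneg max.absorb1 min.absorb2)
  then show ?thesis using assms by (simp add: signed_join_def normalise_id)
qed

lemma sum_abs_vertex: "(\<Sum>a\<in>V. \<bar>if a = p then c else 0 :: real\<bar>) = \<bar>c\<bar>"
proof -
  have "(\<Sum>a\<in>V. \<bar>if a = p then c else 0\<bar>) = (\<Sum>a\<in>V. if a = p then \<bar>c\<bar> else 0)"
    by (intro sum.cong) auto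
  also have "\<dots> = \<bar>c\<bar>"
    using finite_ground facet_subset apex_in_facet by (simp add: sum.delta) blast
  finally show ?thesis .
qed

lemma octa_flow_1:
  assumes "bump S x = 0"
  shows "normalise V (octa_flow S p 1 x) = (\<lambda>a. if a = p then - 1 else 0)"
proof -
  have "octa_flow S p 1 x = (\<lambda>a. if a = p then - 1 else 0)"
    using assms by (auto simp: octa_flow_def Let_def fun_eq_iff)
  then show ?thesis using sum_abs_vertex[of "- 1"] by (simp add: normalise_id)
qed

text \<open>Needed for the wedge: slices resting at the base point must stay there during the whole
  homotopy.\<close>

lemma octa_flow_base:
  assumes "0 \<le> t" "t \<le> 1"
  shows "normalise V (octa_flow S p t (\<lambda>a. if a = p then - 1 else 0)) = (\<lambda>a. if a = p then - 1 else 0)"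
    (is "normalise V (octa_flow S p t ?n) = ?n")
proof -
  have "bump S ?n = 0" by (rule bump_eq_0[OF finite_facet apex_in_facet]) simp
  then have "octa_flow S p t ?n = ?n"
    using assms by (auto simp: octa_flow_def Let_def fun_eq_iff algebra_simps)
  then show ?thesis using sum_abs_vertex[of "- 1"] by (simp add: normalise_id)
qed

text \<open>A nonpositive coordinate in \<open>S\<close> stays nonpositive, since all other terms of
  the flow are subtracted there. So the part to be collapsed is carried into itself.\<close>

lemma octa_flow_bump:
  assumes "bump S x = 0" "0 \<le> t" "t \<le> 1"
  shows "bump S (normalise V (octa_flow S p t x)) = 0"
proof -
  obtain s where s: "s \<in> S" "x s \<le> 0" using bump_attained[OF finite_facet facet_nonempty, of x] assms(1) by auto
  have "(1 - t) * x s \<le> 0" using s assms by (simp add: mult_nonneg_nonpos)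
  moreover have "0 \<le> t * (1 - t) * max 0 (x p)" using assms by simp
  moreover have "octa_flow S p t x s =
      (1 - t) * x s - (if s = p then t else 0) - t * (1 - t) * max 0 (x p)"
    using assms s by (simp add: octa_flow_def Let_def)
  moreover have "0 \<le> (if s = p then t else 0)" using assms by simp
  ultimately have "octa_flow S p t x s \<le> 0" by linarith
  then have "normalise V (octa_flow S p t x) s \<le> 0"
    by (simp add: normalise_def divide_nonpos_nonneg sum_nonneg)
  then show ?thesis using finite_facet s by (intro bump_eq_0)
qed

lemma continuous_on_octa_flow:
  fixes f :: "'c::topological_space \<Rightarrow> 'a \<Rightarrow> real"
  assumes f: "\<And>a. continuous_on T (\<lambda>q. f q a)" and u: "continuous_on T u"
    and T: "\<And>q. q \<in> T \<Longrightarrow> f q \<in> signed_join V S L \<and> 0 \<le> u q \<and> u q \<le> 1"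
  shows "continuous_on T (\<lambda>q. normalise V (octa_flow S p (u q) (f q)) a)"
proof (rule continuous_on_normalise)
  have b: "continuous_on T (\<lambda>q. bump S (f q))"
    using continuous_on_bump[OF finite_facet facet_nonempty] f by blast
  have if_cont: "continuous_on T (\<lambda>q. if P then g q else 0)" if "continuous_on T g"
    for P and g :: "'c \<Rightarrow> real"
    using that by (cases P) auto
  show "continuous_on T (\<lambda>q. octa_flow S p (u q) (f q) a)" for a
    unfolding octa_flow_def Let_def
    using card_facet_pos
    by (intro continuous_intros if_cont b f u continuous_on_max continuous_on_min) auto
qed (use octa_flow_nonzero T in blast)

end

section \<open>Collapsing the star of the vertex\<close>

context good_supports
begin

abbreviation "V \<equiv> verts G"
abbreviation "polyK \<equiv> signed_join V {} K"

text \<open>At most one summand is nonzero on \<open>polyK\<close>, by uniqueness of the support in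
  a face. Summing makes the choice of that support continuous, and the zero set is the star of
  \<open>v\<close>.\<close>

definition total_bump :: "('a \<Rightarrow> real) \<Rightarrow> real" where
  "total_bump x = (\<Sum>S\<in>supports. bump S x)"

text \<open>Sends the star of \<open>v\<close> to the origin and is injective elsewhere, because on
  \<open>polyK\<close> the coordinate sum of the image recovers the scaling factor. The image is
  thus the quotient of \<open>polyK\<close> by that star.\<close>

definition collapse :: "('a \<Rightarrow> real) \<Rightarrow> 'a \<Rightarrow> real" where
  "collapse x a = total_bump x * x a"

text \<open>
  On a face containing a support \<open>S\<close>, no weight may be put on \<open>v\<close> before the minimum over \<open>S\<close> has been
  removed; \<open>\<tau>\<close> delays the straight-line contraction to \<open>v\<close> until then.
\<close>

definition cone_flow :: "real \<Rightarrow> ('a \<Rightarrow> real) \<Rightarrow> 'a \<Rightarrow> real" where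
  "cone_flow t x a = (let \<tau> = max 0 (t - 2 * real r * total_bump x) in
     (1 - \<tau>) * (x a - (\<Sum>S\<in>supports. if a \<in> S then min (bump S x) (t / (2 * real r)) else 0))
     + (if a = v then \<tau> else 0))"

section \<open>Bumps and the cone flow on the realization of \<open>Ind r G\<close>\<close>

lemma polyKD:
  assumes "x \<in> polyK"
  shows "\<And>a. 0 \<le> x a" "{a. x a \<noteq> 0} \<in> K" "(\<Sum>a\<in>V. x a) = 1" "\<And>a. a \<notin> V \<Longrightarrow> x a = 0"
  using assms by (auto simp: signed_join_def)

lemma total_bump_nonneg: "0 \<le> total_bump x"
  by (simp add: total_bump_def sum_nonneg bump_nonneg)

lemma total_bump_eq_0_iff: "total_bump x = 0 \<longleftrightarrow> (\<forall>S\<in>supports. bump S x = 0)"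
  unfolding total_bump_def using finite_supports by (subst sum_nonneg_eq_0_iff) (auto simp: bump_nonneg)

lemma bump_pos_subset:
  assumes "S \<in> supports" "0 < bump S x"
  shows "S \<subseteq> {a. x a \<noteq> 0}"
  using assms bump_pos_iff[OF supportD(4,5)[OF assms(1)], of x] by force

text \<open>The geometric form of \<open>support_unique\<close>: both supports lie in the carrier of
  \<open>x\<close>, which is a face.\<close>

lemma bump_pos_unique:
  assumes "x \<in> polyK" "S \<in> supports" "0 < bump S x" "S' \<in> supports" "0 < bump S' x"
  shows "S = S'"
  using support_unique[OF assms(2,4) bump_pos_subset bump_pos_subset polyKD(2)[OF assms(1)]] assms by blast

lemma bump_zero_other:
  assumes "x \<in> polyK" "S \<in> supports" "0 < bump S x" "S' \<in> supports" "S' \<noteq> S"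
  shows "bump S' x = 0"
  using bump_pos_unique[OF assms(1-4)] assms(5) bump_nonneg[of S' x] by force

lemma total_bump_eq:
  assumes "x \<in> polyK" "S \<in> supports" "0 < bump S x"
  shows "total_bump x = bump S x"
proof -
  have "total_bump x = (\<Sum>S'\<in>{S}. bump S' x)"
    unfolding total_bump_def using assms finite_supports bump_zero_other[OF assms]
    by (intro sum.mono_neutral_right) auto
  then show ?thesis by simp
qed

lemma sum_collapse: "x \<in> polyK \<Longrightarrow> (\<Sum>a\<in>V. collapse x a) = total_bump x"
  using polyKD(3)[of x] by (simp add: collapse_def flip: sum_distrib_left)

lemma collapse_eqD:
  assumes "x \<in> polyK" "y \<in> polyK" "collapse x = collapse y"
  shows "total_bump x = total_bump y" "total_bump x \<noteq> 0 \<Longrightarrow> x = y"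
proof -
  show t: "total_bump x = total_bump y"
    using sum_collapse[OF assms(1)] sum_collapse[OF assms(2)] assms(3) by simp
  assume "total_bump x \<noteq> 0"
  with t fun_cong[OF assms(3)] show "x = y" by (auto simp: collapse_def fun_eq_iff)
qed

lemma cone_flow_total_0:
  assumes "total_bump x = 0" "0 \<le> t"
  shows "cone_flow t x a = (1 - t) * x a + (if a = v then t else 0)"
proof -
  have "(\<Sum>S\<in>supports. if a \<in> S then min (bump S x) (t / (2 * real r)) else 0) = 0"
    using assms by (intro sum.neutral) (auto simp: total_bump_eq_0_iff)
  then show ?thesis using assms by (simp add: cone_flow_def)
qed

lemma sum_cone_total_0:
  assumes "x \<in> polyK"
  shows "(\<Sum>a\<in>V. (1 - t) * x a + (if a = v then t else 0)) = 1"
  using polyKD(3)[OF assms] v_in by (simp add: sum.distrib flip: sum_distrib_left)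

lemma no_support_in_carrier:
  assumes "x \<in> polyK" "total_bump x = 0" "S \<in> supports"
  shows "\<not> S \<subseteq> {a. x a \<noteq> 0}"
proof
  assume "S \<subseteq> {a. x a \<noteq> 0}"
  then have "\<forall>s\<in>S. 0 < x s" using polyKD(1)[OF assms(1)] by (force simp: less_le)
  then have "0 < bump S x" using bump_pos_iff supportD(4,5)[OF assms(3)] by blast
  then show False using assms by (simp add: total_bump_eq_0_iff)
qed

lemma cone_flow_bump:
  assumes "x \<in> polyK" "S \<in> supports" "0 < bump S x" "0 \<le> t"
  shows "cone_flow t x a = (let \<tau> = max 0 (t - 2 * real r * bump S x) in
     (1 - \<tau>) * (x a - (if a \<in> S then min (bump S x) (t / (2 * real r)) else 0))
     + (if a = v then \<tau> else 0))"
proof -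
  have "(\<Sum>S'\<in>supports. if a \<in> S' then min (bump S' x) (t / (2 * real r)) else 0) =
      (\<Sum>S'\<in>{S}. if a \<in> S' then min (bump S' x) (t / (2 * real r)) else 0)"
    using assms finite_supports bump_zero_other[OF assms(1-3)]
    by (intro sum.mono_neutral_right) auto
  then show ?thesis by (simp add: cone_flow_def total_bump_eq[OF assms(1-3)])
qed

text \<open>Over the star of \<open>v\<close> the flow is a straight line to \<open>v\<close> inside
  a face. Elsewhere a single support \<open>S\<close> matters: first its weights shrink, costing at
  most \<open>t / 2\<close> in total, and weight goes to \<open>v\<close> only once \<open>S\<close>
  has left the carrier.\<close>

lemma cone_flow_props:
  assumes x: "x \<in> polyK" and t: "0 \<le> t" "t \<le> 1"
  shows "0 < (\<Sum>a\<in>V. \<bar>cone_flow t x a\<bar>)" "normalise V (cone_flow t x) \<in> polyK"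
proof -
  note xD = polyKD[OF x]
  have *: "0 < (\<Sum>a\<in>V. \<bar>cone_flow t x a\<bar>) \<and> (\<forall>a. a \<notin> V \<longrightarrow> cone_flow t x a = 0) \<and>
      (\<forall>a. 0 \<le> cone_flow t x a) \<and> {a. cone_flow t x a \<noteq> 0} \<in> K"
  proof (cases "total_bump x = 0")
    case True
    note flow = cone_flow_total_0[OF True t(1)]
    have nn: "0 \<le> cone_flow t x a" for a using xD(1)[of a] t by (simp add: flow)
    then have "(\<Sum>a\<in>V. \<bar>cone_flow t x a\<bar>) = 1"
      using sum_cone_total_0[OF x] by (simp add: flow)
    moreover have "insert v {a. x a \<noteq> 0} \<in> K"
      using insert_v_in_K[OF xD(2)] no_support_in_carrier[OF x True] by blast
    then have "{a. cone_flow t x a \<noteq> 0} \<in> K"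
      by (rule Ind_subset[OF graph]) (auto simp: flow)
    moreover have "cone_flow t x a = 0" if "a \<notin> V" for a
      using that xD(4)[of a] v_in by (auto simp: flow)
    ultimately show ?thesis using nn by simp
  next
    case False
    then obtain S where S: "S \<in> supports" "0 < bump S x"
      using bump_nonneg by (auto simp: total_bump_eq_0_iff less_le)
    note SD = supportD[OF S(1)]
    define m where "m = bump S x"
    define d where "d = min m (t / (2 * real r))"
    define \<tau> where "\<tau> = max 0 (t - 2 * real r * m)"
    have flow: "cone_flow t x a = (1 - \<tau>) * (x a - (if a \<in> S then d else 0)) + (if a = v then \<tau> else 0)" for a
      using cone_flow_bump[OF x S t(1)] by (simp add: Let_def m_def d_def \<tau>_def)
    have m: "0 < m" "\<And>s. s \<in> S \<Longrightarrow> m \<le> x s"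
      using S bump_le[OF SD(4)] by (auto simp: m_def)
    have "0 \<le> 2 * real r * m" using m by simp
    then have "t - 2 * real r * m \<le> 1" using t by linarith
    then have \<tau>: "0 \<le> \<tau>" "\<tau> \<le> 1" by (auto simp: \<tau>_def)
    have "d \<le> m" by (simp add: d_def)
    then have nn0: "0 \<le> (1 - \<tau>) * (x a - (if a \<in> S then d else 0))" for a
      using m(2)[of a] xD(1)[of a] \<tau> by (intro mult_nonneg_nonneg) auto
    have nn: "0 \<le> cone_flow t x a" for a
      using nn0[of a] \<tau> by (simp add: flow)
    have out: "cone_flow t x a = 0" if "a \<notin> V" for a
      using that xD(4)[of a] v_in SD(1) by (auto simp: flow)
    have "0 < (\<Sum>a\<in>V. cone_flow t x a) \<and> {a. cone_flow t x a \<noteq> 0} \<in> K"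
    proof (cases "\<tau> = 0")
      case True
      have "(\<Sum>a\<in>V. if a \<in> S then d else 0) = (\<Sum>a\<in>S. d)"
        using finite_verts SD(1) by (intro sum.mono_neutral_cong_right) auto
      moreover have flow0: "cone_flow t x a = x a - (if a \<in> S then d else 0)" for a
        using True by (simp add: flow)
      ultimately have "(\<Sum>a\<in>V. cone_flow t x a) = 1 - real r * d"
        using xD(3) SD(3) by (simp add: sum_subtractf)
      moreover have "real r * d \<le> real r * (t / (2 * real r))"
        by (intro mult_left_mono) (auto simp: d_def)
      moreover have "real r * (t / (2 * real r)) = t / 2" using r_pos by simp
      ultimately have "0 < (\<Sum>a\<in>V. cone_flow t x a)" using t by simp
      moreover have "{a. cone_flow t x a \<noteq> 0} \<subseteq> {a. x a \<noteq> 0}"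
        using bump_pos_subset[OF S] by (auto simp: flow0)
      ultimately show ?thesis using Ind_subset[OF graph xD(2)] by blast
    next
      case False
      then have "2 * real r * m < t" using \<tau> by (auto simp: \<tau>_def)
      then have dm: "d = m" using r_pos by (simp add: d_def field_simps)
      have "\<tau> \<le> cone_flow t x v" using nn0[of v] by (simp add: flow)
      then have "0 < cone_flow t x v" using False \<tau> by linarith
      moreover have "cone_flow t x v \<le> (\<Sum>a\<in>V. cone_flow t x a)"
        using v_in nn by (intro member_le_sum) auto
      ultimately have pos: "0 < (\<Sum>a\<in>V. cone_flow t x a)" by linarith
      \<comment> \<open>The carrier after subtracting \<open>m\<close> on \<open>S\<close>. A
        support inside \<open>A\<close> would have to be \<open>S\<close> itself, but
        \<open>S\<close> has lost the vertices where its minimum is attained; hence \<open>v\<close>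
        may be added to \<open>A\<close>.\<close>
      define A where "A = {a. x a \<noteq> 0 \<and> \<not> (a \<in> S \<and> x a = m)}"
      have AK: "A \<in> K" by (rule Ind_subset[OF graph xD(2)]) (auto simp: A_def)
      have "\<not> S' \<subseteq> A" if "S' \<in> supports" for S'
      proof
        assume S': "S' \<subseteq> A"
        then have "S' = S"
          using support_unique[OF that S(1) _ bump_pos_subset[OF S] xD(2)] by (auto simp: A_def)
        moreover obtain s where "s \<in> S" "x s \<le> m"
          using bump_attained[OF SD(4,5)] by (auto simp: m_def)
        ultimately show False using S' m(2)[of s] by (force simp: A_def)
      qed
      then have "insert v A \<in> K" by (rule insert_v_in_K[OF AK])
      moreover have "{a. cone_flow t x a \<noteq> 0} \<subseteq> insert v A"
        using bump_pos_subset[OF S] by (auto simp: flow dm A_def)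
      ultimately show ?thesis using pos Ind_subset[OF graph] by blast
    qed
    with nn out show ?thesis by simp
  qed
  then show "0 < (\<Sum>a\<in>V. \<bar>cone_flow t x a\<bar>)" by blast
  show "normalise V (cone_flow t x) \<in> polyK"
    by (rule normalise_in_signed_join) (use * in auto)
qed

lemma cone_flow_0:
  assumes "x \<in> polyK"
  shows "normalise V (cone_flow 0 x) = x"
proof -
  have "0 \<le> 2 * real r * total_bump x" by (simp add: total_bump_nonneg)
  then have "max 0 (0 - 2 * real r * total_bump x) = 0" by simp
  moreover have "(\<Sum>S\<in>supports. if a \<in> S then min (bump S x) (0 / (2 * real r)) else 0) = 0" for a
    by (intro sum.neutral) (auto simp: bump_nonneg)
  ultimately have "cone_flow 0 x = x"
    by (simp add: cone_flow_def Let_def fun_eq_iff)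
  moreover have "(\<Sum>a\<in>V. \<bar>x a\<bar>) = 1" using assms unfolding signed_join_def by blast
  ultimately show ?thesis by (simp add: normalise_id)
qed

text \<open>Each support has a vertex with coordinate 0; since it differs from \<open>v\<close>, the
  straight-line flow leaves that coordinate 0.\<close>

lemma cone_flow_stable:
  assumes "x \<in> polyK" "total_bump x = 0" "0 \<le> t" "t \<le> 1"
  shows "total_bump (normalise V (cone_flow t x)) = 0"
  unfolding total_bump_eq_0_iff
proof
  fix S assume S: "S \<in> supports"
  obtain s where s: "s \<in> S" "x s \<le> 0"
    using bump_attained[OF supportD(4,5)[OF S], of x] assms(2) S by (auto simp: total_bump_eq_0_iff)
  then have "x s = 0" using polyKD(1)[OF assms(1), of s] by simp
  then have "normalise V (cone_flow t x) s = 0"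
    using cone_flow_total_0[OF assms(2,3)] s(1) supportD(2)[OF S] by (auto simp: normalise_def)
  then show "bump S (normalise V (cone_flow t x)) = 0"
    using supportD(4)[OF S] s(1) by (intro bump_eq_0) auto
qed

lemma cone_flow_1:
  assumes "total_bump x = 0"
  shows "normalise V (cone_flow 1 x) = (\<lambda>a. if a = v then 1 else 0)"
proof -
  have "cone_flow 1 x = (\<lambda>a. if a = v then 1 else 0)"
    using cone_flow_total_0[OF assms, of 1] by auto
  moreover have "(\<Sum>a\<in>V. \<bar>if a = v then 1 else 0 :: real\<bar>) = (\<Sum>a\<in>V. if a = v then 1 else 0)"
    by (intro sum.cong) auto
  ultimately show ?thesis using v_in by (simp add: normalise_id)
qed

lemma continuous_on_total_bump: "continuous_on T total_bump"
  unfolding total_bump_def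
  by (intro continuous_intros continuous_on_bump supportD continuous_on_coordinate)

lemma continuous_on_cone_flow:
  "continuous_on ({0..1} \<times> polyK) (\<lambda>(t, x). normalise V (cone_flow t x))"
proof (intro continuous_on_coordinatewise_then_product)
  fix a
  have coord: "continuous_on ({0..1::real} \<times> polyK) (\<lambda>q. snd q b)" for b
    by (rule continuous_on_compose2[OF continuous_on_coordinate[of UNIV]])
      (auto intro: continuous_on_snd[OF continuous_on_id])
  have tb: "continuous_on ({0..1::real} \<times> polyK) (\<lambda>q. total_bump (snd q))"
    by (rule continuous_on_compose2[OF continuous_on_total_bump[of UNIV]])
      (auto intro: continuous_on_snd[OF continuous_on_id])
  have if_cont: "continuous_on T (\<lambda>q. if P then g q else 0)" if "continuous_on T g"
    for P T and g :: "real \<times> ('a \<Rightarrow> real) \<Rightarrow> real"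
    using that by (cases P) auto
  have "continuous_on ({0..1} \<times> polyK) (\<lambda>q. normalise V (cone_flow (fst q) (snd q)) a)"
  proof (rule continuous_on_normalise)
    show "continuous_on ({0..1} \<times> polyK) (\<lambda>q. cone_flow (fst q) (snd q) a)" for a
      unfolding cone_flow_def Let_def
      using r_pos
      by (intro continuous_intros if_cont tb coord continuous_on_max continuous_on_min
          continuous_on_bump supportD) auto
  qed (use cone_flow_props(1) in auto)
  then show "continuous_on ({0..1} \<times> polyK) (\<lambda>q. (case q of (t, x) \<Rightarrow> normalise V (cone_flow t x)) a)"
    by (simp add: split_beta)
qed

lemma realization_K: "realization K = top_of_set polyK"
  using realization_eq_signed_join[OF finite_verts, of K] by (auto simp: in_K_iff)

lemma compact_realization_Ind:
  assumes "graph H" "verts H \<subseteq> V"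
  shows "compact_space (realization (Ind r H))"
  using assms finite_subset[OF assms(2) finite_verts] Ind_subset[OF assms(1)]
  by (intro compact_space_realization[of "verts H"]) (auto simp: in_Ind_iff)

lemma realization_K_collapse:
  "realization K homotopy_equivalent_space top_of_set (collapse ` polyK)"
proof (rule collapse_homotopy_equivalent)
  show "compact_space (realization K)" using compact_realization_Ind[OF graph] by simp
  show "Hausdorff_space (top_of_set (collapse ` polyK))" by (rule Hausdorff_space_fun)
  have "continuous_on polyK collapse"
    unfolding collapse_def
    by (intro continuous_on_coordinatewise_then_product continuous_intros continuous_on_total_bump
        continuous_on_coordinate)
  then show "continuous_map (realization K) (top_of_set (collapse ` polyK)) collapse"
    by (auto simp: realization_K continuous_map_in_subtopology)
  show "continuous_map (prod_topology (top_of_set {0..1}) (realization K)) (realization K)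
      (\<lambda>(t, x). normalise V (cone_flow t x))"
    using continuous_on_cone_flow cone_flow_props(2)
    by (auto simp: realization_K continuous_map_in_subtopology)
  fix x y assume xy: "x \<in> topspace (realization K)" "y \<in> topspace (realization K)" "collapse x = collapse y"
  then have K: "x \<in> polyK" "y \<in> polyK" by (auto simp: realization_K)
  \<comment> \<open>The only nontrivial fibre of \<open>collapse\<close> is the star of
    \<open>v\<close>, which the flow preserves and finally sends to \<open>v\<close>.\<close>
  have c: "x = y \<or> (total_bump x = 0 \<and> total_bump y = 0)"
    using collapse_eqD[OF K xy(3)] by auto
  then show "(case (1, x) of (t, x) \<Rightarrow> normalise V (cone_flow t x)) =
      (case (1, y) of (t, x) \<Rightarrow> normalise V (cone_flow t x))"
    by (auto simp: cone_flow_1)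
  fix t :: real assume "t \<in> {0..1}"
  then show "collapse (case (t, x) of (t, x) \<Rightarrow> normalise V (cone_flow t x)) =
      collapse (case (t, y) of (t, x) \<Rightarrow> normalise V (cone_flow t x))"
    using c K by (auto simp: collapse_def[abs_def] cone_flow_stable)
qed (auto simp: realization_K cone_flow_0)

end

section \<open>Collapsing the wedge of suspensions\<close>

locale pointed_supports = good_supports +
  fixes p :: "'a set \<Rightarrow> 'a"
  assumes p_in: "S \<in> Supp r v G \<Longrightarrow> p S \<in> S"
begin

text \<open>The negative vertex \<open>-p S\<close>. It is the base point of the slice and the image
  of the pole \<open>North\<close>, whose new coordinate is \<open>-1\<close>.\<close>

definition south :: "'a set \<Rightarrow> 'a \<Rightarrow> real" where
  "south S = (\<lambda>a. if a = p S then - 1 else 0)"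

abbreviation "octa S \<equiv> signed_join V S (L S)"

text \<open>The wedge as a subspace of the product: all slices but one sit at the base point.\<close>

definition wedge_model :: "('a set \<times> 'a \<Rightarrow> real) set" where
  "wedge_model = {X. (\<forall>S\<in>supports. curry X S \<in> octa S) \<and> (\<forall>S a. S \<notin> supports \<longrightarrow> X (S, a) = 0) \<and>
     (\<exists>T. \<forall>S\<in>supports. S \<noteq> T \<longrightarrow> curry X S = south S)}"

text \<open>The counterpart of \<open>collapse\<close>, with values in the same space. Base points
  have bump 0, so at most one slice contributes.\<close>

definition wedge_collapse :: "('a set \<times> 'a \<Rightarrow> real) \<Rightarrow> 'a \<Rightarrow> real" where
  "wedge_collapse X a = (\<Sum>S\<in>supports. bump S (curry X S) * X (S, a))"

definition wedge_flow :: "real \<Rightarrow> ('a set \<times> 'a \<Rightarrow> real) \<Rightarrow> 'a set \<times> 'a \<Rightarrow> real" where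
  "wedge_flow t X =
    (\<lambda>(S, a). if S \<in> supports then normalise V (octa_flow S (p S) t (curry X S)) a else 0)"

text \<open>The inclusion of the slice \<open>T\<close>. If \<open>T\<close> is not a support, the
  value is the base point of the wedge; the empty set serves for this, since supports are
  nonempty.\<close>

definition wedge_point :: "'a set \<Rightarrow> ('a \<Rightarrow> real) \<Rightarrow> 'a set \<times> 'a \<Rightarrow> real" where
  "wedge_point T x = (\<lambda>(S, a). if S \<notin> supports then 0 else if S = T then x a else south S a)"

section \<open>Comparison of the wedge model with the collapsed complex\<close>

lemma L_empty: "S \<in> supports \<Longrightarrow> {} \<in> L S"
  by (simp add: Ind_empty graph_delete_verts graph)

lemma octa_context:
  assumes "S \<in> supports"
  shows "finite V" "S \<subseteq> V" "p S \<in> S" "{} \<in> L S"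
  using assms supportD p_in L_empty by auto

lemma south_in:
  assumes "S \<in> supports"
  shows "south S \<in> octa S"
proof -
  have "{a. a \<notin> S \<and> south S a \<noteq> 0} = {}" using p_in[OF assms] by (auto simp: south_def)
  moreover have "(\<Sum>a\<in>V. \<bar>south S a\<bar>) = 1"
    using sum_abs_vertex[OF octa_context[OF assms], of "- 1"] by (simp add: south_def)
  ultimately show ?thesis
    using octa_context[OF assms] by (auto simp: signed_join_def south_def)
qed

lemma bump_south: "S \<in> supports \<Longrightarrow> bump S (south S) = 0"
  using supportD(4) p_in by (intro bump_eq_0[of S "p S"]) (auto simp: south_def)

lemma curry_wedge_point:
  "S \<in> supports \<Longrightarrow> curry (wedge_point T x) S = (if S = T then x else south S)"
  by (auto simp: wedge_point_def fun_eq_iff)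

lemma wedge_point_in:
  assumes "T \<in> supports \<Longrightarrow> x \<in> octa T"
  shows "wedge_point T x \<in> wedge_model"
  using assms south_in by (auto simp: wedge_model_def curry_wedge_point) (auto simp: wedge_point_def)

lemma wedge_model_eq_point:
  assumes "X \<in> wedge_model" "T \<in> supports" "\<And>S. S \<in> supports \<Longrightarrow> S \<noteq> T \<Longrightarrow> curry X S = south S"
  shows "X = wedge_point T (curry X T)"
proof (intro ext, clarify)
  fix S a
  show "X (S, a) = wedge_point T (curry X T) (S, a)"
  proof (cases "S \<in> supports \<and> S \<noteq> T")
    case True
    then have "curry X S a = south S a" by (simp add: assms(3))
    with True show ?thesis by (simp add: wedge_point_def)
  next
    case False
    then show ?thesis using assms(1,2) by (auto simp: wedge_model_def wedge_point_def)
  qed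
qed

text \<open>The bump vanishes at base points, so \<open>T\<close> must be the one exceptional
  slice.\<close>

lemma wedge_model_bump:
  assumes "X \<in> wedge_model" "T \<in> supports" "0 < bump T (curry X T)"
  shows "X = wedge_point T (curry X T)"
proof (rule wedge_model_eq_point[OF assms(1,2)])
  obtain T' where "\<forall>S\<in>supports. S \<noteq> T' \<longrightarrow> curry X S = south S"
    using assms(1) by (auto simp: wedge_model_def)
  note T' = this[rule_format]
  have "T = T'" using T'[of T] bump_south[of T] assms(2,3) by (cases "T = T'") auto
  then show "\<And>S. S \<in> supports \<Longrightarrow> S \<noteq> T \<Longrightarrow> curry X S = south S" using T' by simp
qed

text \<open>Where all coordinates in \<open>T\<close> are positive no sign is left to distinguish,
  and the face conditions agree because \<open>L T\<close> is the link of \<open>T\<close>. The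
  uncollapsed parts of both spaces therefore coincide.\<close>

lemma octa_bump_iff:
  assumes "T \<in> supports" "0 < bump T x"
  shows "x \<in> octa T \<longleftrightarrow> x \<in> polyK"
proof -
  have pos: "\<forall>s\<in>T. 0 < x s" using assms bump_pos_iff supportD(4,5) by blast
  then have "T \<subseteq> {a. x a \<noteq> 0}" by force
  from join_in_K_iff[OF assms(1) this]
  have "{a. x a \<noteq> 0} \<in> K \<longleftrightarrow> {a. a \<notin> T \<and> x a \<noteq> 0} \<in> L T"
    by (simp add: set_diff_eq conj_commute)
  moreover have "(\<forall>a. 0 \<le> x a) \<longleftrightarrow> (\<forall>a. a \<notin> T \<longrightarrow> 0 \<le> x a)"
    using pos by (meson less_imp_le)
  ultimately show ?thesis by (simp add: signed_join_def)
qed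

lemma wedge_collapse_point:
  assumes "T \<in> supports" "x \<in> polyK" "0 < bump T x"
  shows "wedge_collapse (wedge_point T x) = collapse x"
proof
  fix a
  have "wedge_collapse (wedge_point T x) a =
      (\<Sum>S\<in>{T}. bump S (curry (wedge_point T x) S) * wedge_point T x (S, a))"
    unfolding wedge_collapse_def using assms(1) finite_supports
    by (intro sum.mono_neutral_right) (auto simp: curry_wedge_point bump_south)
  also have "\<dots> = collapse x a"
    using assms by (simp add: curry_wedge_point collapse_def total_bump_eq) (simp add: wedge_point_def)
  finally show "wedge_collapse (wedge_point T x) a = collapse x a" .
qed

lemma wedge_model_cases:
  assumes "X \<in> wedge_model"
  obtains (flat) "\<And>S. S \<in> supports \<Longrightarrow> bump S (curry X S) = 0" "wedge_collapse X = (\<lambda>_. 0)"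
  | (peak) T x where "T \<in> supports" "x \<in> polyK" "0 < bump T x" "X = wedge_point T x"
proof (cases "\<forall>S\<in>supports. bump S (curry X S) = 0")
  case True
  then show ?thesis by (intro flat) (auto simp: wedge_collapse_def)
next
  case False
  then obtain T where T: "T \<in> supports" "0 < bump T (curry X T)"
    using bump_nonneg by (metis less_le)
  moreover have "curry X T \<in> octa T" using assms T by (simp add: wedge_model_def)
  ultimately show ?thesis
    using wedge_model_bump[OF assms T] octa_bump_iff[OF T] by (intro peak) auto
qed

text \<open>Points with a positive bump have nonzero image, and there the claim reduces to
  injectivity of \<open>collapse\<close>; the slice is determined since only one bump can be
  positive.\<close>

lemma wedge_collapse_eqD:
  assumes "X \<in> wedge_model" "Y \<in> wedge_model" "wedge_collapse X = wedge_collapse Y"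
  shows "X = Y \<or> (\<forall>S\<in>supports. bump S (curry X S) = 0 \<and> bump S (curry Y S) = 0)"
proof -
  have nz: "collapse x \<noteq> (\<lambda>_. 0)" if "T \<in> supports" "x \<in> polyK" "0 < bump T x" for T x
    using sum_collapse[OF that(2)] total_bump_eq[OF that(2,1,3)] that(3) by auto
  from assms(1) show ?thesis
  proof (cases rule: wedge_model_cases)
    case X: flat
    from assms(2) show ?thesis
    proof (cases rule: wedge_model_cases)
      case flat
      then show ?thesis using X by blast
    next
      case (peak T y)
      then show ?thesis using X nz assms(3) by (simp add: wedge_collapse_point)
    qed
  next
    case X: (peak T x)
    from assms(2) show ?thesis
    proof (cases rule: wedge_model_cases)
      case flat
      then show ?thesis using X nz assms(3) by (simp add: wedge_collapse_point)
    next
      case (peak T' y)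
      then have "collapse x = collapse y" using X assms(3) by (simp add: wedge_collapse_point)
      moreover have "total_bump x \<noteq> 0" using X total_bump_eq by simp
      ultimately have "x = y" using collapse_eqD(2) X peak by blast
      moreover have "T = T'" using bump_pos_unique X peak \<open>x = y\<close> by blast
      ultimately show ?thesis using X peak by blast
    qed
  qed
qed

lemma wedge_collapse_image: "wedge_collapse ` wedge_model = collapse ` polyK"
proof (intro equalityI subsetI)
  fix z assume "z \<in> wedge_collapse ` wedge_model"
  then obtain X where X: "X \<in> wedge_model" "z = wedge_collapse X" by blast
  from X(1) show "z \<in> collapse ` polyK"
  proof (cases rule: wedge_model_cases)
    case flat
    \<comment> \<open>The vertex \<open>v\<close> lies in no support, so it realizes the origin as a
      value of \<open>collapse\<close>.\<close>
    let ?e = "\<lambda>a. if a = v then 1 else 0 :: real"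
    have "(\<Sum>a\<in>V. \<bar>?e a\<bar>) = (\<Sum>a\<in>V. ?e a)" by (intro sum.cong) auto
    then have "?e \<in> polyK"
      using v_in v_singleton_in_K by (auto simp: signed_join_def)
    moreover have "bump S ?e = 0" if S: "S \<in> supports" for S
    proof -
      obtain s where "s \<in> S" using supportD(5)[OF S] by blast
      moreover from this have "s \<noteq> v" using supportD(2)[OF S] by blast
      ultimately show ?thesis using supportD(4)[OF S] by (intro bump_eq_0[of S s]) auto
    qed
    then have "collapse ?e = z"
      using flat(2) X(2) total_bump_eq_0_iff[of ?e] by (auto simp: collapse_def)
    ultimately show ?thesis by blast
  next
    case (peak T x)
    then show ?thesis using X(2) wedge_collapse_point by auto
  qed
next
  fix z assume "z \<in> collapse ` polyK"
  then obtain x where x: "x \<in> polyK" "z = collapse x" by blast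
  show "z \<in> wedge_collapse ` wedge_model"
  proof (cases "total_bump x = 0")
    case True
    \<comment> \<open>The base point of the wedge realizes the origin, even if there are no
      supports.\<close>
    have "wedge_point {} undefined \<in> wedge_model"
      using supportD(5) by (intro wedge_point_in) blast
    moreover have "wedge_collapse (wedge_point {} undefined) = z"
      using True x supportD(5)
      by (auto simp: wedge_collapse_def collapse_def curry_wedge_point fun_eq_iff bump_south
          intro!: sum.neutral)
    ultimately show ?thesis by blast
  next
    case False
    then obtain T where T: "T \<in> supports" "0 < bump T x"
      using bump_nonneg by (auto simp: total_bump_eq_0_iff less_le)
    then have "wedge_point T x \<in> wedge_model"
      using octa_bump_iff[OF T] x by (intro wedge_point_in) auto
    then show ?thesis using wedge_collapse_point[OF T(1) x(1) T(2)] x(2) by force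
  qed
qed

lemma curry_wedge_flow:
  "S \<in> supports \<Longrightarrow> curry (wedge_flow t X) S = normalise V (octa_flow S (p S) t (curry X S))"
  by (auto simp: wedge_flow_def)

lemma wedge_flow_in:
  assumes "X \<in> wedge_model" "0 \<le> t" "t \<le> 1"
  shows "wedge_flow t X \<in> wedge_model"
proof -
  obtain T where "\<forall>S\<in>supports. S \<noteq> T \<longrightarrow> curry X S = south S"
    using assms(1) by (auto simp: wedge_model_def)
  note T = this[rule_format]
  have "curry (wedge_flow t X) S \<in> octa S" if "S \<in> supports" for S
    using that assms octa_flow_in[OF octa_context[OF that], of "curry X S" t]
    by (simp add: curry_wedge_flow wedge_model_def)
  moreover have "curry (wedge_flow t X) S = south S" if "S \<in> supports" "S \<noteq> T" for S
    using T[OF that] octa_flow_base[OF octa_context[OF that(1)] assms(2,3)] that(1)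
    by (simp add: curry_wedge_flow south_def)
  ultimately show ?thesis
    by (auto simp: wedge_model_def) (auto simp: wedge_flow_def)
qed

lemma wedge_flow_0:
  assumes "X \<in> wedge_model"
  shows "wedge_flow 0 X = X"
proof (intro ext, clarify)
  fix S a
  show "wedge_flow 0 X (S, a) = X (S, a)"
    using assms octa_flow_0[OF octa_context[of S], of "curry X S"]
    by (auto simp: wedge_flow_def wedge_model_def)
qed

lemma continuous_on_slice: "continuous_on T (\<lambda>X. curry X S a :: real)"
  using continuous_on_coordinate[of T "(S, a)"] by (simp add: curry_def)

lemma continuous_on_wedge_flow:
  "continuous_on ({0..1} \<times> wedge_model) (\<lambda>(t, X). wedge_flow t X)"
proof (intro continuous_on_coordinatewise_then_product)
  fix i :: "'a set \<times> 'a"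
  obtain S a where i: "i = (S, a)" by fastforce
  have "continuous_on ({0..1} \<times> wedge_model)
      (\<lambda>q. normalise V (octa_flow S (p S) (fst q) (curry (snd q) S)) a)" if "S \<in> supports"
  proof (rule continuous_on_octa_flow[OF octa_context[OF that]])
    show "continuous_on ({0..1} \<times> wedge_model) (\<lambda>q. curry (snd q) S a)" for a
      by (rule continuous_on_compose2[OF continuous_on_slice[of UNIV]])
        (auto intro: continuous_on_snd[OF continuous_on_id])
    show "continuous_on ({0..1} \<times> wedge_model) fst"
      by (rule continuous_on_fst[OF continuous_on_id])
  qed (use that in \<open>auto simp: wedge_model_def\<close>)
  then show "continuous_on ({0..1} \<times> wedge_model) (\<lambda>q. (case q of (t, X) \<Rightarrow> wedge_flow t X) i)"
    by (cases "S \<in> supports") (auto simp: i wedge_flow_def split_beta)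
qed

text \<open>Compactness is assumed here; it is later carried over from the wedge by the
  homeomorphism.\<close>

lemma wedge_model_collapse:
  assumes "compact_space (top_of_set wedge_model)"
  shows "top_of_set wedge_model homotopy_equivalent_space top_of_set (collapse ` polyK)"
proof (rule collapse_homotopy_equivalent[OF assms])
  show "Hausdorff_space (top_of_set (collapse ` polyK))" by (rule Hausdorff_space_fun)
  have "continuous_on wedge_model (\<lambda>X. wedge_collapse X a)" for a
    unfolding wedge_collapse_def
    by (intro continuous_on_sum continuous_on_mult continuous_on_bump continuous_on_slice
        continuous_on_coordinate supportD)
  then have "continuous_on wedge_model wedge_collapse"
    by (rule continuous_on_coordinatewise_then_product)
  then show "continuous_map (top_of_set wedge_model) (top_of_set (collapse ` polyK)) wedge_collapse"
    using wedge_collapse_image by (auto simp: continuous_map_in_subtopology)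
  show "wedge_collapse ` topspace (top_of_set wedge_model) = topspace (top_of_set (collapse ` polyK))"
    using wedge_collapse_image by simp
  show "continuous_map (prod_topology (top_of_set {0..1}) (top_of_set wedge_model)) (top_of_set wedge_model)
      (\<lambda>(t, X). wedge_flow t X)"
    using continuous_on_wedge_flow wedge_flow_in by (auto simp: continuous_map_in_subtopology)
  fix X Y assume XY: "X \<in> topspace (top_of_set wedge_model)" "Y \<in> topspace (top_of_set wedge_model)"
    "wedge_collapse X = wedge_collapse Y"
  then have c: "X = Y \<or> (\<forall>S\<in>supports. bump S (curry X S) = 0 \<and> bump S (curry Y S) = 0)"
    using wedge_collapse_eqD by simp
  have one: "wedge_flow 1 X = wedge_flow 1 Y"
    if "\<forall>S\<in>supports. bump S (curry X S) = 0 \<and> bump S (curry Y S) = 0"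
    unfolding wedge_flow_def using that octa_flow_1[OF octa_context] by auto
  then show "(case (1, X) of (t, X) \<Rightarrow> wedge_flow t X) = (case (1, Y) of (t, X) \<Rightarrow> wedge_flow t X)"
    using c by auto
  fix t :: real assume t: "t \<in> {0..1}"
  have zero: "wedge_collapse (wedge_flow t Z) = (\<lambda>_. 0)"
    if "\<forall>S\<in>supports. bump S (curry Z S) = 0" for Z
    using that t octa_flow_bump[OF octa_context]
    by (auto simp: wedge_collapse_def curry_wedge_flow intro!: sum.neutral)
  then show "wedge_collapse (case (t, X) of (t, X) \<Rightarrow> wedge_flow t X) =
      wedge_collapse (case (t, Y) of (t, X) \<Rightarrow> wedge_flow t X)"
    using c by auto
qed (simp add: wedge_flow_0)

end

section \<open>Identification of the wedge of suspensions with its model\<close>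

context good_supports
begin

abbreviation "susp_L S \<equiv> iterated_suspension r (realization (L S))"

lemma wedge_coordinates:
  obtains p \<theta> where "\<And>S. S \<in> supports \<Longrightarrow> p S \<in> S"
    "\<And>S. S \<in> supports \<Longrightarrow> continuous_map (susp_L S) euclidean (\<theta> S)"
    "\<And>S. S \<in> supports \<Longrightarrow> inj_on (\<theta> S) (topspace (susp_L S))"
    "\<And>S. S \<in> supports \<Longrightarrow> \<theta> S ` topspace (susp_L S) = signed_join V S (L S)"
    "\<And>S. S \<in> supports \<Longrightarrow> \<theta> S North = (\<lambda>a. if a = p S then - 1 else 0)"
proof -
  define good where "good S q \<eta> \<longleftrightarrow> q \<in> S \<and> continuous_map (susp_L S) euclidean \<eta> \<and>
      inj_on \<eta> (topspace (susp_L S)) \<and> \<eta> ` topspace (susp_L S) = signed_join V S (L S) \<and>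
      \<eta> North = (\<lambda>a. if a = q then - 1 else 0)" for S q \<eta>
  have "\<exists>q \<eta>. good S q \<eta>"
    if S: "S \<in> supports" for S
  proof -
    \<comment> \<open>Since \<open>card S = r\<close>, each of the \<open>r\<close> suspensions uses
      up one vertex of \<open>S\<close>; the last one, \<open>s (r - 1)\<close>, becomes
      \<open>p S\<close>.\<close>
    obtain s where "bij_betw s {0..<card S} S"
      using ex_bij_betw_nat_finite[OF supportD(4)[OF S]] by blast
    then have s: "inj_on s {..<r}" "s ` {..<r} = S"
      using supportD(3)[OF S] by (auto simp: bij_betw_def atLeast0LessThan)
    have LV: "A \<subseteq> V" "A \<inter> S = {}" if "A \<in> L S" for A
      using that in_L_iff[OF S] by (auto simp: in_K_iff closed_nbhd_def)
    have "{} \<in> L S" by (simp add: Ind_empty graph_delete_verts graph)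
    then obtain \<eta> where \<eta>: "continuous_map (susp_L S) euclidean \<eta>" "inj_on \<eta> (topspace (susp_L S))"
      "\<eta> ` topspace (susp_L S) = signed_join V S (L S)" "\<eta> North = (\<lambda>a. if a = s (r - 1) then - 1 else 0)"
      using iterated_suspension_coordinates[OF finite_verts, of "L S" s r] s LV supportD(1)[OF S] r_pos
      by auto
    moreover have "s (r - 1) \<in> S" using s(2) r_pos by auto
    ultimately show ?thesis unfolding good_def by blast
  qed
  then have "\<exists>p. \<forall>S\<in>supports. \<exists>\<eta>. good S (p S) \<eta>" by (intro bchoice) blast
  then obtain p where "\<forall>S\<in>supports. \<exists>\<eta>. good S (p S) \<eta>" ..
  then have "\<exists>\<theta>. \<forall>S\<in>supports. good S (p S) (\<theta> S)" by (rule bchoice)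
  then obtain \<theta> where "\<forall>S\<in>supports. good S (p S) (\<theta> S)" ..
  then show ?thesis by (intro that[of p \<theta>]) (simp_all add: good_def)
qed

text \<open>The coordinates of the slices glue to a continuous bijection from the compact wedge to
  the Hausdorff model, hence to a homeomorphism.\<close>

lemma wedge_homeomorphic_model:
  obtains p where "pointed_supports G r v p"
    "wedge supports susp_L (\<lambda>_. North) homeomorphic_space
      top_of_set (pointed_supports.wedge_model G r v p)"
    "compact_space (top_of_set (pointed_supports.wedge_model G r v p))"
proof (rule wedge_coordinates)
  fix p \<theta>
  assume p: "\<And>S. S \<in> supports \<Longrightarrow> p S \<in> S"
    and \<theta>: "\<And>S. S \<in> supports \<Longrightarrow> continuous_map (susp_L S) euclidean (\<theta> S)"
      "\<And>S. S \<in> supports \<Longrightarrow> inj_on (\<theta> S) (topspace (susp_L S))"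
      "\<And>S. S \<in> supports \<Longrightarrow> \<theta> S ` topspace (susp_L S) = signed_join V S (L S)"
      "\<And>S. S \<in> supports \<Longrightarrow> \<theta> S North = (\<lambda>a. if a = p S then - 1 else 0)"
  interpret P: pointed_supports G r v p
    by unfold_locales (rule p)
  let ?W = "wedge supports susp_L (\<lambda>_. North)"
  have North: "North \<in> topspace (susp_L S)" for S
    using North_in_iterated_suspension[OF r_pos] .
  define \<Phi> where "\<Phi> w = (case w of None \<Rightarrow> P.wedge_point {} undefined
    | Some (T, y) \<Rightarrow> P.wedge_point T (\<theta> T y))" for w
  \<comment> \<open>All poles \<open>North\<close> go to the same point, so \<open>\<Phi>\<close> is
    compatible with the identification in the wedge.\<close>
  have south: "P.wedge_point T (\<theta> T North) = P.wedge_point {} undefined" if "T \<in> supports" for T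
    using that \<theta>(4)[OF that] supportD(5) by (auto simp: P.wedge_point_def P.south_def fun_eq_iff)
  have proj: "\<Phi> (wedge_proj (\<lambda>_. North) (T, y)) = P.wedge_point T (\<theta> T y)" if "T \<in> supports" for T y
    using south[OF that] by (auto simp: \<Phi>_def wedge_proj_def)
  have top: "topspace ?W = insert None {Some (T, y) | T y. T \<in> supports \<and> y \<in> topspace (susp_L T) \<and> y \<noteq> North}"
    unfolding wedge_def by (subst topspace_final_topology) (force simp: wedge_proj_def)+
  have compact: "compact_space ?W"
  proof (rule compact_space_wedge[OF finite_supports])
    fix S
    have "verts (delete_verts G (closed_nbhd G S)) \<subseteq> V" by (auto simp: delete_verts_def)
    then show "compact_space (susp_L S)"
      by (intro compact_space_iterated_suspension compact_realization_Ind graph_delete_verts graph)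
  qed
  have cont: "continuous_map ?W euclidean \<Phi>"
    unfolding wedge_def
  proof (rule continuous_map_from_final_topology)
    show "continuous_map (sum_topology susp_L supports) euclidean (\<Phi> \<circ> wedge_proj (\<lambda>_. North))"
    proof (rule continuous_map_from_sum_topology)
      fix T assume T: "T \<in> supports"
      have "continuous_map (susp_L T) (powertop_real UNIV) (\<theta> T)"
        using \<theta>(1)[OF T] by (simp add: euclidean_product_topology)
      then have "continuous_map (susp_L T) euclideanreal (\<lambda>y. \<theta> T y a)" for a
        by (auto simp: continuous_map_componentwise_UNIV)
      then have "continuous_map (susp_L T) euclideanreal (\<lambda>y. P.wedge_point T (\<theta> T y) i)" for i
        by (cases i) (auto simp: P.wedge_point_def)
      then have "continuous_map (susp_L T) (powertop_real UNIV) (\<lambda>y. P.wedge_point T (\<theta> T y))"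
        by (simp add: continuous_map_componentwise_UNIV)
      then show "continuous_map (susp_L T) euclidean (\<lambda>y. (\<Phi> \<circ> wedge_proj (\<lambda>_. North)) (T, y))"
        by (simp add: euclidean_product_topology proj[OF T])
    qed
  qed auto
  have point_inj: "T = T' \<and> x = x'"
    if "P.wedge_point T x = P.wedge_point T' x'" "T \<in> supports" "T' \<in> supports"
      "x \<noteq> P.south T" "x' \<noteq> P.south T'" for T T' x x'
  proof -
    \<comment> \<open>Comparing the slices \<open>T\<close> and \<open>T'\<close> suffices: if they
      differed, one of the two points would show its base point where the other does not.\<close>
    have "curry (P.wedge_point T x) S = curry (P.wedge_point T' x') S" for S
      using that(1) by simp
    from this[of T] this[of T'] that(2-) show ?thesis
      by (auto simp: P.curry_wedge_point split: if_splits)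
  qed
  have ne: "\<theta> T y \<noteq> P.south T" if "T \<in> supports" "y \<in> topspace (susp_L T)" "y \<noteq> North" for T y
    using inj_onD[OF \<theta>(2)[OF that(1)] _ that(2) North] \<theta>(4)[OF that(1)] that(3)
    by (auto simp: P.south_def)
  have ne0: "P.wedge_point T x \<noteq> P.wedge_point {} undefined" if "T \<in> supports" "x \<noteq> P.south T" for T x
  proof
    assume "P.wedge_point T x = P.wedge_point {} undefined"
    then have "curry (P.wedge_point T x) T = curry (P.wedge_point {} undefined) T" by simp
    with that supportD(5) show False by (auto simp: P.curry_wedge_point split: if_splits)
  qed
  have inj: "inj_on \<Phi> (topspace ?W)"
  proof (rule inj_onI)
    fix w w' assume w: "w \<in> topspace ?W" "w' \<in> topspace ?W" "\<Phi> w = \<Phi> w'"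
    show "w = w'"
    proof (cases w)
      case None
      then show ?thesis using w ne ne0 unfolding top by (force simp: \<Phi>_def)
    next
      case (Some q)
      then obtain T y where Ty: "w = Some (T, y)" "T \<in> supports" "y \<in> topspace (susp_L T)" "y \<noteq> North"
        using w(1) unfolding top by blast
      show ?thesis
      proof (cases w')
        case None
        then show ?thesis using w(3) Ty ne ne0 by (force simp: \<Phi>_def)
      next
        case (Some q)
        then obtain T' y' where Ty': "w' = Some (T', y')" "T' \<in> supports" "y' \<in> topspace (susp_L T')" "y' \<noteq> North"
          using w(2) unfolding top by blast
        have "T = T' \<and> \<theta> T y = \<theta> T' y'"
          using w(3) Ty Ty' ne by (intro point_inj) (auto simp: \<Phi>_def)
        then show ?thesis
          using Ty Ty' inj_onD[OF \<theta>(2)[OF Ty(2)]] by auto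
      qed
    qed
  qed
  have image: "\<Phi> ` topspace ?W = P.wedge_model"
  proof (intro equalityI subsetI)
    fix X assume "X \<in> \<Phi> ` topspace ?W"
    moreover have "\<theta> T y \<in> P.octa T" if "T \<in> supports" "y \<in> topspace (susp_L T)" for T y
      using \<theta>(3)[OF that(1)] that(2) by blast
    ultimately show "X \<in> P.wedge_model"
      unfolding top using supportD(5) by (auto simp: \<Phi>_def intro!: P.wedge_point_in)
  next
    fix X assume X: "X \<in> P.wedge_model"
    then obtain T where "\<forall>S\<in>supports. S \<noteq> T \<longrightarrow> curry X S = P.south S"
      by (auto simp: P.wedge_model_def)
    note T = this[rule_format]
    show "X \<in> \<Phi> ` topspace ?W"
    proof (cases "T \<in> supports")
      case True
      then have "curry X T \<in> \<theta> T ` topspace (susp_L T)"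
        using X \<theta>(3) by (simp add: P.wedge_model_def)
      then obtain y where y: "y \<in> topspace (susp_L T)" "curry X T = \<theta> T y" by blast
      then have "X = \<Phi> (wedge_proj (\<lambda>_. North) (T, y))"
        using P.wedge_model_eq_point[OF X True T] proj[OF True] by simp
      moreover have "wedge_proj (\<lambda>_. North) (T, y) \<in> topspace ?W"
        using True y unfolding top by (auto simp: wedge_proj_def)
      ultimately show ?thesis by blast
    next
      case False
      \<comment> \<open>The exceptional index is no support, so every slice is at its base point;
        this includes the empty wedge.\<close>
      have "X i = P.wedge_point {} undefined i" for i
      proof -
        obtain S a where i: "i = (S, a)" by fastforce
        show ?thesis
          using X T[of S] False supportD(5)
          by (auto simp: i P.wedge_point_def P.wedge_model_def fun_eq_iff)
      qed
      then have "X = \<Phi> None" by (auto simp: \<Phi>_def)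
      then show ?thesis unfolding top by blast
    qed
  qed
  have Haus: "Hausdorff_space (top_of_set P.wedge_model)" by (rule Hausdorff_space_fun)
  have cont': "continuous_map ?W (top_of_set P.wedge_model) \<Phi>"
    using cont image by (auto simp: continuous_map_in_subtopology)
  have "homeomorphic_map ?W (top_of_set P.wedge_model) \<Phi>"
    using continuous_imp_homeomorphic_map[OF cont' compact Haus] image inj by simp
  then have hs: "?W homeomorphic_space top_of_set P.wedge_model"
    by (rule homeomorphic_map_imp_homeomorphic_space)
  then have "compact_space (top_of_set P.wedge_model)"
    using compact homeomorphic_compact_space by blast
  then show thesis by (rule that[OF P.pointed_supports_axioms hs])
qed

end

theorem theorem4p2:
  fixes G :: "('a, 'b) pre_digraph" and r :: nat and v :: 'a
  assumes "graph G" and "connected_graph G"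
    and "r \<ge> 1" and "v \<in> verts G"
    and "Supp_connected r v G"
    and "\<forall>S\<in>Supp r v G. nbhd G {v} \<subseteq> closed_nbhd G S"
  shows "realization (Ind r G) homotopy_equivalent_space
    wedge (Supp r v G)
      (\<lambda>S. iterated_suspension r (realization (Ind r (delete_verts G (closed_nbhd G S)))))
      (\<lambda>S. North)"
proof -
  interpret good_supports G r v
    using assms by (intro good_supports.intro)
  obtain p where p: "pointed_supports G r v p"
    "wedge supports susp_L (\<lambda>_. North) homeomorphic_space
      top_of_set (pointed_supports.wedge_model G r v p)"
    "compact_space (top_of_set (pointed_supports.wedge_model G r v p))"
    by (rule wedge_homeomorphic_model)
  have "wedge supports susp_L (\<lambda>_. North) homotopy_equivalent_space
      top_of_set (pointed_supports.wedge_model G r v p)"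
    using p(2) by (rule homeomorphic_imp_homotopy_equivalent_space)
  also have "\<dots> homotopy_equivalent_space top_of_set (collapse ` polyK)"
    using pointed_supports.wedge_model_collapse[OF p(1,3)] .
  finally have "top_of_set (collapse ` polyK) homotopy_equivalent_space
      wedge supports susp_L (\<lambda>_. North)"
    by (subst homotopy_equivalent_space_sym)
  with realization_K_collapse show ?thesis
    by (rule homotopy_eqv_trans)
qed

end
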